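(* For every $T\ge1$ and either convention E ($\varepsilon=0$) or N ($\varepsilon=1$) there exist a probability distribution with finite support over pairs (admissible total order $\preceq$ on $X$, target $z\in X$) and a fixed sequence of the $T$ instances such that, with the memoryless minimal-prefix oracle $S\mapsto\mathcal O_{\min}(S,\preceq)$, every randomized learner satisfies $$\mathbb E[M]\ \ge\ \frac{(T+1-\varepsilon)\,128^{-\mathbb E[Q]}-1}{2},$$ the expectations being over the distribution and the learner's private randomness. In particular, if $\mathbb E[Q]\le q$ (or $Q\le q$ almost surely), then $$\mathbb E[M]\ge\max\Big\{0,\ \frac{(T+1-\varepsilon)\,128^{-q}-1}{2}\Big\};$$ and for every randomized learner with the uniform expected-query guarantee $\mathbb E[Q]\le q$ on every instance (order and target), there is a fixed instance $(\preceq,z)$ on which this last lower bound on $\mathbb E[M]$ holds, the expectation now being over the learner's randomness only.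
   Context: Domain and conventions. There are $T$ distinct instances, announced in advance as a sequence $x_1,\dots,x_T$ in order of arrival. Convention E: $X=\{s,x_1,\dots,x_T\}$ and only total orders on $X$ in which the sentinel $s$ is the minimum are admissible; $\varepsilon=0$. Convention N: $X=\{x_1,\dots,x_T\}$, all total orders on $X$ are admissible; $\varepsilon=1$. For a total order $\preceq$ on $X$ and $z\in X$ let $c_z(x)=\mathbf 1[x\preceq z]$ and $C_\preceq=\{c_z:z\in X\}$. Oracle. A sample is a set $S\subseteq X\times\{0,1\}$. $\mathcal O_{\min}(S,\preceq)$ returns (as a full label vector on $X$) the indicator of the smallest prefix in $C_\preceq$ consistent with $S$, or $\bot$ if no concept of $C_\preceq$ is consistent with $S$. Protocol. The learner knows the convention, $X$, $T$, the sequence and the rule, but not $\preceq$ or $z$. In round $t$ it predicts $\hat y_t\in\{0,1\}$ and then sees $y_t=c_z(x_t)$. At any time it may call the oracle on any adaptively chosen sample; each call costs one. $M$ is the number of mistakes ($\hat y_t\neq y_t$) and $Q$ the number of oracle calls. A randomized learner uses private random bits independent of the instance, which is fixed (or drawn) before the learner's randomness. *)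

theory Defs
  imports "HOL-Probability.Probability"
begin

text \<open>Under convention E the domain carries an additional sentinel, recorded in the
  constructor.\<close>

datatype 'a convention = Conv_E 'a | Conv_N

primrec eps :: "'a convention \<Rightarrow> real" where
  "eps (Conv_E s) = 0"
| "eps Conv_N = 1"

primrec sentinel_fresh :: "'a convention \<Rightarrow> 'a set \<Rightarrow> bool" where
  "sentinel_fresh (Conv_E s) I \<longleftrightarrow> s \<notin> I"
| "sentinel_fresh Conv_N I \<longleftrightarrow> True"

primrec points :: "'a convention \<Rightarrow> 'a set \<Rightarrow> 'a set" where
  "points (Conv_E s) I = insert s I"
| "points Conv_N I = I"

primrec sentinel_least :: "'a convention \<Rightarrow> 'a set \<Rightarrow> 'a rel \<Rightarrow> bool" where
  "sentinel_least (Conv_E s) I r \<longleftrightarrow> (\<forall>x\<in>insert s I. (s, x) \<in> r)"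
| "sentinel_least Conv_N I r \<longleftrightarrow> True"

definition admissible :: "'a convention \<Rightarrow> 'a set \<Rightarrow> 'a rel \<Rightarrow> bool" where
  "admissible conv I r \<longleftrightarrow> linear_order_on (points conv I) r \<and> sentinel_least conv I r"

definition problems :: "'a convention \<Rightarrow> 'a set \<Rightarrow> ('a rel \<times> 'a) set" where
  "problems conv I = {(r, z). admissible conv I r \<and> z \<in> points conv I}"

text \<open>Label vectors on \<open>X\<close> are functions on the whole type; as \<open>r \<subseteq> X \<times> X\<close>, the concepts
  below are \<open>False\<close> outside \<open>X\<close>.\<close>

definition prefix_concept :: "'a rel \<Rightarrow> 'a \<Rightarrow> 'a \<Rightarrow> bool" where
  "prefix_concept r z x \<longleftrightarrow> (x, z) \<in> r"

definition concepts :: "'a set \<Rightarrow> 'a rel \<Rightarrow> ('a \<Rightarrow> bool) set" where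
  "concepts X r = prefix_concept r ` X"

definition consistent :: "('a \<times> bool) set \<Rightarrow> ('a \<Rightarrow> bool) \<Rightarrow> bool" where
  "consistent S c \<longleftrightarrow> (\<forall>(x, b)\<in>S. c x = b)"

text \<open>The order used by \<open>LEAST\<close> is the pointwise one, i.e. inclusion of prefixes.\<close>

definition oracle_min :: "'a set \<Rightarrow> 'a rel \<Rightarrow> ('a \<times> bool) set \<Rightarrow> ('a \<Rightarrow> bool) option" where
  "oracle_min X r S =
     (if \<exists>c\<in>concepts X r. consistent S c
      then Some (LEAST c. c \<in> concepts X r \<and> consistent S c)
      else None)"

text \<open>A deterministic learner is a well-founded interaction tree: \<open>Ask S k\<close> calls the oracle on
  \<open>S\<close> and continues with the answer, \<open>Guess b k\<close> predicts \<open>b\<close> for the next instance and continues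
  with the revealed label. Oracle calls are possible at any time, also before the first and after
  the last prediction; well-foundedness says that every run makes finitely many of them.\<close>

datatype 'a learner =
    Ask "('a \<times> bool) set" "('a \<Rightarrow> bool) option \<Rightarrow> 'a learner"
  | Guess bool "bool \<Rightarrow> 'a learner"
  | Halt

text \<open>All samples are over \<open>X\<close>, and exactly \<open>n\<close> predictions are made.\<close>

primrec legal :: "'a set \<Rightarrow> 'a learner \<Rightarrow> nat \<Rightarrow> bool" where
  "legal X (Ask S k) n \<longleftrightarrow> S \<subseteq> X \<times> UNIV \<and> (\<forall>a. legal X (k a) n)"
| "legal X (Guess b k) n \<longleftrightarrow> n > 0 \<and> (\<forall>y. legal X (k y) (n - 1))"
| "legal X Halt n \<longleftrightarrow> n = 0"

text \<open>Mistakes and oracle calls of a run against the oracle \<open>orc\<close>, where \<open>ys\<close> lists the true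
  labels of the instances still to arrive.\<close>

primrec run_mistakes ::
  "(('a \<times> bool) set \<Rightarrow> ('a \<Rightarrow> bool) option) \<Rightarrow> 'a learner \<Rightarrow> bool list \<Rightarrow> nat" where
  "run_mistakes orc (Ask S k) ys = run_mistakes orc (k (orc S)) ys"
| "run_mistakes orc (Guess b k) ys =
     (if b \<noteq> hd ys then 1 else 0) + run_mistakes orc (k (hd ys)) (tl ys)"
| "run_mistakes orc Halt ys = 0"

primrec run_calls ::
  "(('a \<times> bool) set \<Rightarrow> ('a \<Rightarrow> bool) option) \<Rightarrow> 'a learner \<Rightarrow> bool list \<Rightarrow> nat" where
  "run_calls orc (Ask S k) ys = Suc (run_calls orc (k (orc S)) ys)"
| "run_calls orc (Guess b k) ys = run_calls orc (k (hd ys)) (tl ys)"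
| "run_calls orc Halt ys = 0"

definition mistakes :: "'a convention \<Rightarrow> 'a list \<Rightarrow> 'a learner \<Rightarrow> 'a rel \<times> 'a \<Rightarrow> nat" where
  "mistakes conv xs A = (\<lambda>(r, z).
     run_mistakes (oracle_min (points conv (set xs)) r) A (map (prefix_concept r z) xs))"

definition oracle_calls :: "'a convention \<Rightarrow> 'a list \<Rightarrow> 'a learner \<Rightarrow> 'a rel \<times> 'a \<Rightarrow> nat" where
  "oracle_calls conv xs A = (\<lambda>(r, z).
     run_calls (oracle_min (points conv (set xs)) r) A (map (prefix_concept r z) xs))"

text \<open>A randomized learner chooses a deterministic one from an infinite sequence of private bits.
  The law \<open>R\<close> of the bits is arbitrary (fair coin flips being a special case). The only
  measurability required is the one that makes the two costs random variables.\<close>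

definition randomized_learner ::
  "'a convention \<Rightarrow> 'a list \<Rightarrow> (nat \<Rightarrow> bool) measure \<Rightarrow> ((nat \<Rightarrow> bool) \<Rightarrow> 'a learner) \<Rightarrow> bool" where
  "randomized_learner conv xs R L \<longleftrightarrow>
     prob_space R \<and>
     (\<forall>\<omega>\<in>space R. legal (points conv (set xs)) (L \<omega>) (length xs)) \<and>
     (\<forall>p\<in>problems conv (set xs).
        (\<lambda>\<omega>. mistakes conv xs (L \<omega>) p) \<in> measurable R (count_space UNIV) \<and>
        (\<lambda>\<omega>. oracle_calls conv xs (L \<omega>) p) \<in> measurable R (count_space UNIV))"

definition expected_mistakes ::
  "'a convention \<Rightarrow> 'a list \<Rightarrow> (nat \<Rightarrow> bool) measure \<Rightarrow> ((nat \<Rightarrow> bool) \<Rightarrow> 'a learner) \<Rightarrow>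
   'a rel \<times> 'a \<Rightarrow> real" where
  "expected_mistakes conv xs R L p = (\<integral>\<omega>. real (mistakes conv xs (L \<omega>) p) \<partial>R)"

text \<open>Unlike the number of mistakes, the number of oracle calls is not bounded, so its expectation
  may be infinite.\<close>

definition expected_calls ::
  "'a convention \<Rightarrow> 'a list \<Rightarrow> (nat \<Rightarrow> bool) measure \<Rightarrow> ((nat \<Rightarrow> bool) \<Rightarrow> 'a learner) \<Rightarrow>
   'a rel \<times> 'a \<Rightarrow> ennreal" where
  "expected_calls conv xs R L p = (\<integral>\<^sup>+\<omega>. of_nat (oracle_calls conv xs (L \<omega>) p) \<partial>R)"

text \<open>The random bits are independent of the drawn problem, so expectations over both are iterated
  integrals.\<close>

definition mean_mistakes ::
  "'a convention \<Rightarrow> 'a list \<Rightarrow> ('a rel \<times> 'a) pmf \<Rightarrow> (nat \<Rightarrow> bool) measure \<Rightarrow>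
   ((nat \<Rightarrow> bool) \<Rightarrow> 'a learner) \<Rightarrow> real" where
  "mean_mistakes conv xs D R L = measure_pmf.expectation D (expected_mistakes conv xs R L)"

definition mean_calls ::
  "'a convention \<Rightarrow> 'a list \<Rightarrow> ('a rel \<times> 'a) pmf \<Rightarrow> (nat \<Rightarrow> bool) measure \<Rightarrow>
   ((nat \<Rightarrow> bool) \<Rightarrow> 'a learner) \<Rightarrow> ennreal" where
  "mean_calls conv xs D R L = (\<integral>\<^sup>+p. expected_calls conv xs R L p \<partial>measure_pmf D)"

text \<open>\<open>128\<^sup>-\<^sup>q\<close> for \<open>q \<in> [0, \<infinity>]\<close>, with value 0 at \<open>\<infinity>\<close>.\<close>

definition pow128_neg :: "ennreal \<Rightarrow> real" where
  "pow128_neg q = (if q = \<infinity> then 0 else 128 powr (- enn2real q))"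

end

theory Submission imports Defs begin

text \<open>One point \<open>s\<close> is always the minimum (the sentinel under convention E, the first instance
  under convention N) and the other instances \<open>J\<close> get independent fair labels. The order is built
  in levels from the outside inwards: among the points \<open>U\<close> still unplaced, the half that arrives
  first goes to the current level, and so does each point of the other half with probability
  \<open>1/2\<close>. On a level, positive points go below and negative points above everything still unplaced.

  The answer to a query only depends on the largest point that the sample labels positive, so it
  reveals no more than the levels up to that point. Conditionally on these levels the labels
  of the unplaced points that have not arrived are fair. Let \<open>G\<close> count the predictions made on
  such points (each is wrong with probability \<open>1/2\<close>) and let \<open>r\<close> be the number of those left. A
  prediction preserves \<open>G + r + 1\<close>. A query lowers \<open>ln (G + r + 1)\<close> by at most \<open>ln 128\<close> on
  average: the arrival order keeps the points of the inner levels from having been seen, so the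
  current level reveals at most a factor 4, and further levels, each again a factor 4, are
  reached with probability at most \<open>9/16\<close>; if the first half has been seen already, then
  \<open>r \<le> G + 1\<close> and at most a factor 2 is lost altogether. In the end \<open>r = 0\<close>, which gives
  \<open>2 E[M] + 1 = E[G + 1] \<ge> (|J| + 1) 128\<^sup>-\<^sup>q\<close> by Jensen's inequality.\<close>

section \<open>Averages over coins\<close>

text \<open>A set of coins records one outcome, its members being heads. This is the conditional
  expectation given the coins outside \<open>C\<close>, read off from \<open>w\<close>, so that
  \<open>w\<close> can serve as the revealed history.\<close>

definition Av :: "'c set \<Rightarrow> ('c set \<Rightarrow> real) \<Rightarrow> 'c set \<Rightarrow> real" where
  "Av C F w = (\<Sum>B\<in>Pow C. F (w - C \<union> B)) / 2 ^ card C"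

lemma Av_empty [simp]: "Av {} F w = F w"
  by (simp add: Av_def)

lemma Av_insert:
  assumes "finite C" "c \<notin> C"
  shows "Av (insert c C) F w = (Av C F (insert c w) + Av C F (w - {c})) / 2"
proof -
  have inj: "inj_on (insert c) (Pow C)"
    using assms(2) by (auto simp: inj_on_def)
  have "(\<Sum>B\<in>Pow (insert c C). F (w - insert c C \<union> B))
      = (\<Sum>B\<in>Pow C. F (w - insert c C \<union> B)) + (\<Sum>B\<in>Pow C. F (w - insert c C \<union> insert c B))"
    unfolding Pow_insert using assms
    by (subst sum.union_disjoint) (auto simp: sum.reindex[OF inj])
  also have "(\<Sum>B\<in>Pow C. F (w - insert c C \<union> B)) = (\<Sum>B\<in>Pow C. F ((w - {c}) - C \<union> B))"
    by (intro sum.cong refl arg_cong[where f=F]) auto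
  also have "(\<Sum>B\<in>Pow C. F (w - insert c C \<union> insert c B)) = (\<Sum>B\<in>Pow C. F (insert c w - C \<union> B))"
    using assms by (intro sum.cong refl arg_cong[where f=F]) auto
  finally show ?thesis
    using assms by (simp add: Av_def add_divide_distrib)
qed

lemma Av_mono:
  assumes "\<And>w'. w' - C = w - C \<Longrightarrow> F w' \<le> H w'"
  shows "Av C F w \<le> Av C H w"
  unfolding Av_def
  by (intro divide_right_mono sum_mono assms) auto

lemma Av_cong:
  assumes "\<And>w'. w' - C = w - C \<Longrightarrow> F w' = H w'"
  shows "Av C F w = Av C H w"
  unfolding Av_def
  by (intro arg_cong2[where f="(/)"] refl sum.cong assms) auto

lemma Av_agree: "w' - C = w - C \<Longrightarrow> Av C F w' = Av C F w"
  by (simp add: Av_def)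

lemma Av_const [simp]: "finite C \<Longrightarrow> Av C (\<lambda>_. a) w = a"
  by (simp add: Av_def card_Pow)

lemma Av_add: "Av C (\<lambda>w. F w + H w) w = Av C F w + Av C H w"
  by (simp add: Av_def sum.distrib add_divide_distrib)

lemma Av_diff: "Av C (\<lambda>w. F w - H w) w = Av C F w - Av C H w"
  by (simp add: Av_def sum_subtractf diff_divide_distrib)

lemma Av_scale: "Av C (\<lambda>w. a * F w) w = a * Av C F w"
  by (simp add: Av_def sum_distrib_left)

lemma Av_union:
  assumes "finite C" "finite D" "C \<inter> D = {}"
  shows "Av (C \<union> D) F w = Av C (Av D F) w"
  using assms by (induction C arbitrary: w rule: finite_induct) (simp_all add: Av_insert)

lemma Av_fixed:
  assumes "finite C" "\<And>w'. w' - C = w - C \<Longrightarrow> F w' = F w"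
  shows "Av C F w = F w"
proof -
  have "Av C F w = Av C (\<lambda>_. F w) w" by (rule Av_cong) (rule assms(2))
  thus ?thesis using assms(1) by simp
qed

lemma Av_subset:
  assumes "finite C" "D \<subseteq> C"
    and "\<And>w' w''. w' - C = w - C \<Longrightarrow> w'' - (C - D) = w' - (C - D) \<Longrightarrow> F w'' = F w'"
  shows "Av C F w = Av D F w"
proof -
  have fin: "finite D" "finite (C - D)" and eq: "C = D \<union> (C - D)"
    using assms(1,2) finite_subset by auto
  have "Av C F w = Av D (Av (C - D) F) w"
    by (subst eq, rule Av_union) (use fin in auto)
  also have "\<dots> = Av D F w"
  proof (rule Av_cong)
    fix w' assume "w' - D = w - D"
    hence "w' - C = w - C" using assms(2) by blast
    thus "Av (C - D) F w' = F w'" by (intro Av_fixed fin assms(3))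
  qed
  finally show ?thesis .
qed

text \<open>Tower property for a random set \<open>R w\<close> of coins whose value is revealed by the coins
  in \<open>K\<close>.\<close>

lemma Av_tower:
  assumes "finite C" "K \<subseteq> C"
    and sub: "\<And>w'. w' - C = w - C \<Longrightarrow> R w' \<subseteq> C - K"
    and eq: "\<And>w1 w2. w1 - (C - K) = w2 - (C - K) \<Longrightarrow> R w1 = R w2"
  shows "Av C F w = Av C (\<lambda>w'. Av (R w') F w') w"
proof -
  have fin: "finite K" "finite (C - K)" and CK: "C = K \<union> (C - K)"
    using assms(1,2) finite_subset by auto
  have "Av C F w = Av K (Av (C - K) F) w" for F
    by (subst CK, rule Av_union) (use fin in auto)
  moreover have "Av K (Av (C - K) F) w = Av K (Av (C - K) (\<lambda>w'. Av (R w') F w')) w"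
  proof (rule Av_cong)
    \<comment> \<open>With the coins outside \<open>C - K\<close> frozen, \<open>R\<close> is
      constant, so the inner average is merely repeated on the fixed set
      \<open>R w1\<close>.\<close>
    fix w1 assume "w1 - K = w - K"
    hence ag: "w1 - C = w - C" using assms(2) by blast
    have R1: "R w1 \<subseteq> C - K" by (rule sub[OF ag])
    have finR: "finite (R w1)" "finite (C - K - R w1)" using R1 fin finite_subset by auto
    have CR: "C - K = (C - K - R w1) \<union> R w1" using R1 by auto
    have step: "Av (C - K) H w1 = Av (C - K - R w1) (Av (R w1) H) w1" for H
      by (subst CR, rule Av_union) (use finR in auto)
    have "Av (C - K) (\<lambda>w'. Av (R w') F w') w1 = Av (C - K) (Av (R w1) F) w1"
    proof (rule Av_cong)
      fix w' assume "w' - (C - K) = w1 - (C - K)"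
      from eq[OF this] show "Av (R w') F w' = Av (R w1) F w'" by simp
    qed
    also have "\<dots> = Av (C - K - R w1) (Av (R w1) (Av (R w1) F)) w1" by (rule step)
    also have "\<dots> = Av (C - K - R w1) (Av (R w1) F) w1"
      by (rule Av_cong, rule Av_fixed) (use finR in \<open>auto intro: Av_agree\<close>)
    finally show "Av (C - K) F w1 = Av (C - K) (\<lambda>w'. Av (R w') F w') w1"
      by (simp add: step)
  qed
  ultimately show ?thesis by metis
qed

section \<open>Sums over subsets by cardinality\<close>

lemma sum_Pow_card:
  fixes f :: "nat \<Rightarrow> 'b::comm_semiring_1"
  assumes "finite H"
  shows "(\<Sum>B\<in>Pow H. f (card B)) = (\<Sum>k\<le>card H. of_nat (card H choose k) * f k)"
proof -
  have "(\<Sum>k\<le>card H. \<Sum>B | B \<in> Pow H \<and> card B = k. f (card B)) = (\<Sum>B\<in>Pow H. f (card B))"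
    using assms by (intro sum.group) (auto intro: card_mono)
  moreover have "(\<Sum>B | B \<in> Pow H \<and> card B = k. f (card B)) = of_nat (card H choose k) * f k" for k
    using n_subsets[OF assms, of k] by simp
  ultimately show ?thesis by simp
qed

text \<open>By absorption, \<open>(h choose k) / (k + 1)\<close> is an entry of row
  \<open>h + 1\<close> divided by \<open>h + 1\<close>, and that row sums to
  \<open>2 ^ (h + 1)\<close>. This bounds the mean of \<open>1 / (k + 1)\<close> for a fair binomial
  \<open>k\<close>.\<close>

lemma sum_Pow_inverse_Suc_card_le:
  assumes "finite H"
  shows "(\<Sum>B\<in>Pow H. 1 / (real (card B) + 1)) \<le> 2 ^ card H * (2 / (real (card H) + 1))"
proof -
  let ?h = "card H"
  have binom: "real (?h choose k) / (real k + 1) = real (Suc ?h choose Suc k) / (real ?h + 1)" for k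
  proof -
    have "real (Suc k * (Suc ?h choose Suc k)) = real (Suc ?h * (?h choose k))"
      by (simp only: Suc_times_binomial)
    thus ?thesis by (simp add: field_simps del: binomial_Suc_Suc)
  qed
  have "(\<Sum>B\<in>Pow H. 1 / (real (card B) + 1)) = (\<Sum>k\<le>?h. real (Suc ?h choose Suc k)) / (real ?h + 1)"
    using sum_Pow_card[OF assms, of "\<lambda>k. 1 / (real k + 1)"]
    by (simp add: binom sum_divide_distrib[symmetric] del: binomial_Suc_Suc)
  also have "(\<Sum>k\<le>?h. real (Suc ?h choose Suc k)) \<le> (\<Sum>k\<le>Suc ?h. real (Suc ?h choose k))"
    by (simp only: sum.atMost_Suc_shift of_nat_0_le_iff le_add_same_cancel2)
  also have "\<dots> = 2 ^ Suc ?h"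
    using choose_row_sum[of "Suc ?h"] by (metis of_nat_numeral of_nat_power of_nat_sum)
  finally show ?thesis by (simp add: divide_right_mono mult.commute)
qed

section \<open>Layered orders\<close>

locale layered_orders =
  fixes s :: 'a and xs :: "'a list" and rk :: "'a \<Rightarrow> nat"
  assumes distinct_xs: "distinct xs"
    and inj_rk: "inj_on rk (insert s (set xs))"
begin

definition X :: "'a set" where "X = insert s (set xs)"

definition J :: "'a set" where "J = set xs - {s}"

text \<open>Rounding down makes the latter half of a nonempty \<open>U\<close> a proper subset, so
  that the levels run out, while \<open>card U + 1 \<le> 2 * (card (latter U) + 1)\<close> still
  holds for \<open>U \<subseteq> J\<close>.\<close>

definition latter :: "'a set \<Rightarrow> 'a set" where
  "latter U = set (drop (card U - card U div 2) (filter (\<lambda>x. x \<in> U) xs))"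

text \<open>The coin \<open>(x, 0)\<close> is the label of \<open>x\<close>, and \<open>(x, Suc j)\<close> decides whether \<open>x\<close> moves
  inwards from level \<open>j\<close>. Level 0 is the outermost one.\<close>

primrec deep :: "nat \<Rightarrow> ('a \<times> nat) set \<Rightarrow> 'a set" where
  "deep 0 w = J"
| "deep (Suc j) w = {x \<in> latter (deep j w). (x, Suc j) \<in> w}"

text \<open>The coins still unknown when levels below \<open>j\<close> are revealed and the labels in \<open>V\<close> are
  not.\<close>

definition coins :: "'a set \<Rightarrow> nat \<Rightarrow> ('a \<times> nat) set" where
  "coins V j = V \<times> {0} \<union> J \<times> {j<..card J}"

text \<open>As the sets \<open>deep i w\<close> decrease in \<open>i\<close>, for \<open>x\<close>
  in \<open>J\<close> this is the last \<open>i\<close> with \<open>x\<close> in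
  \<open>deep i w\<close>.\<close>

definition depth :: "('a \<times> nat) set \<Rightarrow> 'a \<Rightarrow> nat" where
  "depth w x = card {i \<in> {1..card J}. x \<in> deep i w}"

text \<open>Deeper points get blocks nearer to 0, positive ones below 0 and negative ones above. As
  \<open>depth\<close> is at most \<open>card J\<close>, the block of \<open>s\<close> is below all
  others.\<close>

definition block :: "('a \<times> nat) set \<Rightarrow> 'a \<Rightarrow> int" where
  "block w x =
     (if x = s then - int (card J) - 2
      else if (x, 0) \<in> w then int (depth w x) - int (card J) - 1
      else int (card J) + 1 - int (depth w x))"

text \<open>Lexicographic comparison by block, then by \<open>rk\<close>, in a single integer: the
  factor exceeds the rank of every point of \<open>X\<close>.\<close>

definition key :: "('a \<times> nat) set \<Rightarrow> 'a \<Rightarrow> int" where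
  "key w x = block w x * int (Suc (Max (rk ` X))) + int (rk x)"

definition ord :: "('a \<times> nat) set \<Rightarrow> 'a rel" where
  "ord w = {(x, y) \<in> X \<times> X. key w x \<le> key w y}"

definition top_of :: "('a \<times> nat) set \<Rightarrow> 'a set \<Rightarrow> 'a" where
  "top_of w Q = (SOME p. p \<in> Q \<and> (\<forall>x\<in>Q. key w x \<le> key w p))"

text \<open>Including \<open>s\<close> provides a target even when all labels in \<open>J\<close>
  are negative.\<close>

definition target :: "('a \<times> nat) set \<Rightarrow> 'a" where
  "target w = top_of w (insert s {x \<in> J. (x, 0) \<in> w})"

text \<open>Every prefix contains \<open>s\<close>, so adding it imposes no new constraint and keeps
  the set nonempty.\<close>

definition required :: "('a \<times> bool) set \<Rightarrow> 'a set" where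
  "required S = insert s {x. (x, True) \<in> S}"

lemma finite_X [simp]: "finite X" and finite_J [simp]: "finite J"
  and s_in_X [simp]: "s \<in> X" and s_notin_J [simp]: "s \<notin> J"
  and J_subset_X: "J \<subseteq> X" and J_subset_xs: "J \<subseteq> set xs"
  and X_eq: "X = insert s J"
  by (auto simp: X_def J_def)

section \<open>Arrival order and latter halves\<close>

lemma filter_eq: "U \<subseteq> J \<Longrightarrow> set (filter (\<lambda>x. x \<in> U) xs) = U"
  using J_subset_xs by auto

lemma length_filter: "U \<subseteq> J \<Longrightarrow> length (filter (\<lambda>x. x \<in> U) xs) = card U"
  using filter_eq[of U] distinct_card[of "filter (\<lambda>x. x \<in> U) xs"] distinct_xs by simp

lemma latter_subset: "latter U \<subseteq> U"
  unfolding latter_def by (auto dest!: in_set_dropD)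

lemma finite_latter [simp]: "finite (latter U)"
  by (simp add: latter_def)

lemma card_latter:
  assumes "U \<subseteq> J"
  shows "card (latter U) = card U div 2"
proof -
  have "distinct (drop (card U - card U div 2) (filter (\<lambda>x. x \<in> U) xs))"
    using distinct_xs by simp
  from distinct_card[OF this] show ?thesis
    by (simp add: latter_def length_filter[OF assms])
qed

text \<open>Instances arrive in the order of \<open>xs\<close>, so once an element of the latter half has
  arrived, the whole former half has.\<close>

lemma latter_fresh_or_half_seen:
  assumes "U \<subseteq> J" "xs = zs @ ys"
  shows "latter U \<subseteq> set ys \<or> card U \<le> 2 * card (U - set ys)"
proof -
  let ?f = "card U - card U div 2"
  let ?A = "filter (\<lambda>x. x \<in> U) zs" and ?B = "filter (\<lambda>x. x \<in> U) ys"
  show ?thesis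
  proof (cases "length ?A \<le> ?f")
    case True
    have "latter U = set (drop ?f (?A @ ?B))"
      by (simp only: latter_def filter_append[symmetric] assms(2)[symmetric])
    also have "\<dots> \<subseteq> set ?B" using True by (auto dest: in_set_dropD)
    finally show ?thesis by auto
  next
    case False
    have "U - set ys = set ?A"
      using assms distinct_xs J_subset_xs by auto
    moreover have "card (set ?A) = length ?A"
      using assms(2) distinct_xs by (intro distinct_card) simp
    ultimately have "card U - card U div 2 < card (U - set ys)"
      using False by simp
    thus ?thesis by linarith
  qed
qed

section \<open>Levels and what the revealed coins determine\<close>

lemma deep_Suc_subset_latter: "deep (Suc j) w \<subseteq> latter (deep j w)"
  by auto

lemma deep_Suc_subset: "deep (Suc j) w \<subseteq> deep j w"
  using deep_Suc_subset_latter latter_subset by blast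

lemma deep_antimono: "i \<le> j \<Longrightarrow> deep j w \<subseteq> deep i w"
  by (rule lift_Suc_antimono_le[of "\<lambda>j. deep j w"]) (use deep_Suc_subset in auto)

lemma deep_subset_J: "deep j w \<subseteq> J"
  using deep_antimono[of 0 j w] by simp

lemma deep_subset_X: "deep j w \<subseteq> X"
  using deep_subset_J J_subset_X by blast

lemma finite_deep [simp]: "finite (deep j w)"
  using deep_subset_J finite_J finite_subset by blast

lemma card_deep: "card (deep j w) \<le> card J - j"
proof (induction j)
  case (Suc j)
  have "card (deep (Suc j) w) \<le> card (latter (deep j w))"
    by (intro card_mono deep_Suc_subset_latter finite_latter)
  also have "\<dots> = card (deep j w) div 2" by (rule card_latter[OF deep_subset_J])
  finally show ?case using Suc by linarith
qed simp

lemma deep_nonempty_le: "x \<in> deep j w \<Longrightarrow> j < card J"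
  using card_deep[of j w] card_gt_0_iff[of "deep j w"] by fastforce

lemma deep_cong:
  "(\<And>x i. 0 < i \<Longrightarrow> i \<le> j \<Longrightarrow> (x, i) \<in> w1 \<longleftrightarrow> (x, i) \<in> w2) \<Longrightarrow> deep j w1 = deep j w2"
  by (induction j) simp_all

lemma finite_coins [simp]: "finite V \<Longrightarrow> finite (coins V j)"
  by (simp add: coins_def)

lemma agree_iff: "w' - C = w - C \<Longrightarrow> c \<notin> C \<Longrightarrow> c \<in> w' \<longleftrightarrow> c \<in> w"
  by blast

lemma deep_agree:
  assumes "w' - coins V j = w - coins V j" "i \<le> j"
  shows "deep i w' = deep i w"
  by (intro deep_cong agree_iff[OF assms(1)]) (use assms(2) in \<open>auto simp: coins_def\<close>)

lemma depth_le: "depth w x \<le> card J"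
proof -
  have "card {i \<in> {1..card J}. x \<in> deep i w} \<le> card {1..card J}"
    by (intro card_mono) auto
  thus ?thesis by (simp add: depth_def)
qed

lemma depth_less:
  assumes "x \<in> J" "x \<notin> deep j w"
  shows "depth w x < j"
proof -
  have "j \<noteq> 0" using assms by (cases j) auto
  have "{i \<in> {1..card J}. x \<in> deep i w} \<subseteq> {1..<j}"
    using assms deep_antimono[of j _ w] by (auto simp: subset_iff) (meson not_le)
  hence "depth w x \<le> card {1..<j}"
    unfolding depth_def by (intro card_mono) auto
  thus ?thesis using \<open>j \<noteq> 0\<close> by simp
qed

lemma le_depth:
  assumes "x \<in> deep j w"
  shows "j \<le> depth w x"
proof -
  have "{1..j} \<subseteq> {i \<in> {1..card J}. x \<in> deep i w}"
    using assms deep_antimono[of _ j w] deep_nonempty_le[OF assms] by (auto simp: subset_iff)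
  from card_mono[OF _ this] show ?thesis by (simp add: depth_def)
qed

lemma depth_agree:
  assumes "w' - coins V j = w - coins V j" "x \<notin> deep j w"
  shows "depth w' x = depth w x"
proof -
  have eq: "x \<in> deep i w' \<longleftrightarrow> x \<in> deep i w" for i
  proof (cases "i \<le> j")
    case True
    thus ?thesis using deep_agree[OF assms(1)] by simp
  next
    case False
    thus ?thesis
      using assms(2) deep_agree[OF assms(1) order_refl]
        deep_antimono[of j i w] deep_antimono[of j i w'] by auto
  qed
  show ?thesis unfolding depth_def eq by (rule refl)
qed

section \<open>The linear order\<close>

lemma block_less_imp_key_less:
  assumes "block w x < block w y" "x \<in> X"
  shows "key w x < key w y"
proof -
  let ?N = "int (Suc (Max (rk ` X)))"
  have "rk x \<le> Max (rk ` X)" using assms(2) by simp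
  hence "int (rk x) < ?N" by simp
  moreover have "(block w x + 1) * ?N \<le> block w y * ?N"
    using assms(1) by (intro mult_right_mono) auto
  ultimately show ?thesis unfolding key_def by (simp add: algebra_simps)
qed

lemma inj_key: "inj_on (key w) X"
proof (rule inj_onI)
  fix x y assume xy: "x \<in> X" "y \<in> X" and eq: "key w x = key w y"
  have "block w x = block w y"
    using block_less_imp_key_less[of w x y] block_less_imp_key_less[of w y x] xy eq by force
  hence "rk x = rk y" using eq by (simp add: key_def)
  thus "x = y" using inj_rk xy by (auto simp: X_def inj_on_def)
qed

lemma linear_order_ord: "linear_order_on X (ord w)"
  unfolding linear_order_on_def partial_order_on_def preorder_on_def
  using inj_key[of w]
  by (auto simp: refl_on_def trans_def antisym_def total_on_def ord_def inj_on_def)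

lemma block_s_less: "x \<in> X \<Longrightarrow> x \<noteq> s \<Longrightarrow> block w s < block w x"
  using depth_le[of w x] by (simp add: block_def)

lemma s_least: "x \<in> X \<Longrightarrow> key w s \<le> key w x"
  using block_less_imp_key_less[OF block_s_less, of x w] by (cases "x = s") auto

text \<open>Elements still in \<open>deep j w\<close> lie between the positive and the negative ones that have
  left.\<close>

lemma key_deep_le_iff:
  assumes "p \<in> X - deep j w" "x \<in> deep j w"
  shows "key w x \<le> key w p \<longleftrightarrow> p \<noteq> s \<and> (p, 0) \<notin> w"
proof -
  have x: "x \<in> X" "x \<noteq> s" "j \<le> depth w x" "depth w x \<le> card J"
    using assms(2) deep_subset_X deep_subset_J s_notin_J le_depth depth_le by blast+
  show ?thesis
  proof (cases "p = s")
    case True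
    thus ?thesis
      using block_less_imp_key_less[OF block_s_less[OF x(1,2)] s_in_X, of w] by simp
  next
    case False
    hence "depth w p < j" using assms(1) depth_less[of p j w] X_eq by auto
    hence "if (p, 0) \<in> w then block w p < block w x else block w x < block w p"
      using x False by (simp add: block_def)
    thus ?thesis
      using block_less_imp_key_less[of w p x] block_less_imp_key_less[of w x p] assms(1) x(1) False
      by (auto split: if_splits)
  qed
qed

lemma key_agree:
  assumes ag: "w' - coins V j = w - coins V j" and V: "V \<subseteq> deep j w" and x: "x \<notin> deep j w"
  shows "key w' x = key w x"
proof -
  have "(x, 0) \<in> w' \<longleftrightarrow> (x, 0) \<in> w"
    using V x by (intro agree_iff[OF ag]) (auto simp: coins_def)
  thus ?thesis by (simp add: key_def block_def depth_agree[OF ag x])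
qed

text \<open>If \<open>x\<close> is still unplaced, the label of \<open>p\<close> alone decides the
  comparison (\<open>s\<close> counting as positive); otherwise both keys are already determined.
  Hence the prefix ending at a placed point is known even when the order inside it is not.\<close>

lemma key_le_agree:
  assumes ag: "w' - coins V j = w - coins V j" and V: "V \<subseteq> deep j w"
    and p: "p \<in> X - deep j w"
  shows "key w' x \<le> key w' p \<longleftrightarrow> key w x \<le> key w p"
proof (cases "x \<in> deep j w")
  case True
  have "(p, 0) \<in> w' \<longleftrightarrow> (p, 0) \<in> w"
    using V p by (intro agree_iff[OF ag]) (auto simp: coins_def)
  thus ?thesis
    using key_deep_le_iff[of p j w' x] key_deep_le_iff[of p j w x] True p
      deep_agree[OF ag order_refl] by simp
next
  case False
  thus ?thesis using key_agree[OF ag V] p by simp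
qed

section \<open>Largest points, labels and oracle answers\<close>

lemma top_of_props:
  assumes "finite Q" "Q \<noteq> {}"
  shows "top_of w Q \<in> Q" and "x \<in> Q \<Longrightarrow> key w x \<le> key w (top_of w Q)"
proof -
  have "Max (key w ` Q) \<in> key w ` Q" using assms by simp
  then obtain p where "p \<in> Q" "key w p = Max (key w ` Q)" by auto
  hence "p \<in> Q \<and> (\<forall>x\<in>Q. key w x \<le> key w p)" using assms by simp
  from someI[of "\<lambda>p. p \<in> Q \<and> (\<forall>x\<in>Q. key w x \<le> key w p)", OF this]
  show "top_of w Q \<in> Q" and "x \<in> Q \<Longrightarrow> key w x \<le> key w (top_of w Q)"
    by (auto simp: top_of_def)
qed

lemma top_of_eqI:
  assumes "Q \<subseteq> X" "p \<in> Q" "\<And>x. x \<in> Q \<Longrightarrow> key w x \<le> key w p"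
  shows "top_of w Q = p"
proof -
  have Q: "finite Q" "Q \<noteq> {}" using assms(1,2) finite_subset[OF _ finite_X] by auto
  have "key w (top_of w Q) = key w p"
    using top_of_props[OF Q, where w=w] assms by (intro order.antisym) auto
  thus ?thesis
    using inj_key[of w] top_of_props(1)[OF Q] assms by (auto simp: inj_on_def)
qed

lemma prefix_ord: "prefix_concept (ord w) p x \<longleftrightarrow> x \<in> X \<and> p \<in> X \<and> key w x \<le> key w p"
  by (simp add: prefix_concept_def ord_def)

lemma target_in_X: "target w \<in> X"
  using top_of_props(1)[of "insert s {x \<in> J. (x, 0) \<in> w}" w]
  by (auto simp: target_def X_eq)

text \<open>Positive points and \<open>s\<close> have negative blocks, negative points positive
  ones. So the labels on \<open>J\<close> are the label coins themselves, whatever the levels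
  are.\<close>

lemma prefix_target:
  assumes "x \<in> X"
  shows "prefix_concept (ord w) (target w) x \<longleftrightarrow> x = s \<or> (x, 0) \<in> w"
proof -
  let ?Q = "insert s {x \<in> J. (x, 0) \<in> w}"
  have top: "target w \<in> ?Q" "\<And>x. x \<in> ?Q \<Longrightarrow> key w x \<le> key w (target w)"
    using top_of_props[of ?Q, where w=w] by (auto simp: target_def)
  show ?thesis
  proof (cases "x = s \<or> (x, 0) \<in> w")
    case True
    hence "x \<in> ?Q" using assms X_eq by auto
    thus ?thesis using True top(2) assms target_in_X by (simp add: prefix_ord)
  next
    case False
    have "block w (target w) < block w x"
      using top(1) False depth_le[of w x] depth_le[of w "target w"] by (auto simp: block_def)
    hence "key w (target w) < key w x"
      by (rule block_less_imp_key_less) (rule target_in_X)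
    thus ?thesis using False by (simp add: prefix_ord)
  qed
qed

lemma required_props:
  assumes "S \<subseteq> X \<times> UNIV"
  shows "required S \<subseteq> X" "finite (required S)" "required S \<noteq> {}"
proof -
  show "required S \<subseteq> X" using assms by (auto simp: required_def)
  thus "finite (required S)" by (rule finite_subset) simp
qed (simp add: required_def)

text \<open>Every prefix consistent with \<open>S\<close> contains \<open>required S\<close>, hence
  also the prefix ending at its top, which therefore respects the negative labels too. So this
  prefix is the answer unless no prefix is consistent.\<close>

lemma oracle_ord:
  assumes S: "S \<subseteq> X \<times> UNIV"
  defines "c \<equiv> \<lambda>w. prefix_concept (ord w) (top_of w (required S))"
  shows "oracle_min X (ord w) S = (if consistent S (c w) then Some (c w) else None)"
proof -
  let ?p = "top_of w (required S)"
  note req = required_props[OF S]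
  note top = top_of_props[OF req(2,3), where w=w]
  have pX: "?p \<in> X" using top(1) req(1) by blast
  hence conc: "c w \<in> concepts X (ord w)" by (simp add: c_def concepts_def)
  have min: "c w \<le> d \<and> consistent S (c w)" if d: "d \<in> concepts X (ord w)" "consistent S d" for d
  proof -
    obtain y where y: "y \<in> X" "d = prefix_concept (ord w) y"
      using d(1) by (auto simp: concepts_def)
    have "key w x \<le> key w y" if "x \<in> required S" for x
      using that d(2) y s_least[of y w] by (auto simp: required_def consistent_def prefix_ord)
    hence "key w ?p \<le> key w y" using top(1) by blast
    hence le: "c w \<le> d" using y by (auto simp: c_def prefix_ord le_fun_def)
    have "c w x = b" if xb: "(x, b) \<in> S" for x b
    proof (cases b)
      case True
      hence "x \<in> required S" using xb by (simp add: required_def)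
      thus ?thesis using True top(2) req(1) pX by (auto simp: c_def prefix_ord)
    next
      case False
      hence "\<not> d x" using d(2) xb by (auto simp: consistent_def)
      thus ?thesis using False le by (auto simp: le_fun_def)
    qed
    thus ?thesis using le by (auto simp: consistent_def)
  qed
  show ?thesis
  proof (cases "consistent S (c w)")
    case True
    hence "(LEAST d. d \<in> concepts X (ord w) \<and> consistent S d) = c w"
      using conc min by (intro Least_equality) auto
    thus ?thesis using True conc by (auto simp: oracle_min_def)
  next
    case False
    thus ?thesis using min by (auto simp: oracle_min_def)
  qed
qed

lemma top_of_agree:
  assumes ag: "w' - coins V j = w - coins V j" and V: "V \<subseteq> deep j w"
    and Q: "Q \<subseteq> X" "finite Q" "Q \<noteq> {}" and p: "top_of w Q \<notin> deep j w"
  shows "top_of w' Q = top_of w Q"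
proof (rule top_of_eqI[OF Q(1)])
  show "top_of w Q \<in> Q" by (rule top_of_props(1)[OF Q(2,3)])
  fix x assume "x \<in> Q"
  thus "key w' x \<le> key w' (top_of w Q)"
    using key_le_agree[OF ag V] top_of_props[OF Q(2,3)] p Q(1) by blast
qed

text \<open>The answer to a query is determined by the coins revealed so far as soon as the largest
  point that the sample labels positive has left \<open>deep j w\<close>.\<close>

lemma oracle_agree:
  assumes ag: "w' - coins V j = w - coins V j" and V: "V \<subseteq> deep j w"
    and S: "S \<subseteq> X \<times> UNIV" and p: "top_of w (required S) \<notin> deep j w"
  shows "oracle_min X (ord w') S = oracle_min X (ord w) S"
proof -
  note req = required_props[OF S]
  have top: "top_of w' (required S) = top_of w (required S)"
    by (rule top_of_agree[OF ag V req p])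
  have "top_of w (required S) \<in> X"
    using top_of_props(1)[OF req(2,3)] req(1) by blast
  hence "prefix_concept (ord w') (top_of w (required S)) = prefix_concept (ord w) (top_of w (required S))"
    using key_le_agree[OF ag V] p by (auto simp: prefix_ord)
  thus ?thesis by (simp add: oracle_ord[OF S] top)
qed

text \<open>A query that is not answered at level \<open>j + 1\<close> has its largest positive point deeper than
  that, hence no negative point on that level. For one candidate point this has probability
  \<open>1/2\<close>, for two at most \<open>(3/4)\<^sup>2\<close>.\<close>

lemma Av_unanswered_le:
  assumes Q: "Q \<subseteq> X" "Q \<noteq> {}"
  shows "Av (coins (deep j w) j) (\<lambda>w'. of_bool (top_of w' Q \<in> deep (Suc j) w')) w \<le> 9 / 16"
proof -
  let ?C = "coins (deep j w) j"
  let ?H = "latter (deep j w)"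
  let ?ind = "\<lambda>w'. of_bool (top_of w' Q \<in> deep (Suc j) w') :: real"
  have finQ: "finite Q" using Q(1) finite_subset[OF _ finite_X] by blast
  have unanswered: "top_of w' Q \<in> Q \<inter> ?H \<and> (top_of w' Q, Suc j) \<in> w' \<and>
      (\<forall>x\<in>Q \<inter> ?H. (x, 0) \<in> w' \<or> (x, Suc j) \<in> w')"
    if ag: "w' - ?C = w - ?C" and top: "top_of w' Q \<in> deep (Suc j) w'" for w'
  proof (intro conjI ballI)
    note topQ = top_of_props[OF finQ Q(2), where w=w']
    have deep: "deep j w' = deep j w" using deep_agree[OF ag order_refl] .
    show "top_of w' Q \<in> Q \<inter> ?H" "(top_of w' Q, Suc j) \<in> w'"
      using top topQ(1) deep by auto
    fix x assume x: "x \<in> Q \<inter> ?H"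
    show "(x, 0) \<in> w' \<or> (x, Suc j) \<in> w'"
    proof (rule ccontr)
      assume neg: "\<not> ?thesis"
      have "x \<in> X - deep (Suc j) w'" "x \<noteq> s"
        using x neg Q(1) latter_subset[of "deep j w"] deep_subset_J[of j w] s_notin_J by auto
      hence "key w' (top_of w' Q) \<le> key w' x"
        using key_deep_le_iff[OF _ top, of x] neg by simp
      moreover have "key w' x \<le> key w' (top_of w' Q)" using topQ(2) x by blast
      ultimately have "x = top_of w' Q"
        using inj_key[of w'] x topQ(1) Q(1) by (auto simp: inj_on_def)
      thus False using neg top by simp
    qed
  qed
  have coin: "(x, 0) \<in> ?C" "(x, Suc j) \<in> ?C" if "x \<in> ?H" for x
    using that latter_subset[of "deep j w"] deep_subset_J[of j w] deep_nonempty_le[of x j w]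
    by (auto simp: coins_def)
  consider "Q \<inter> ?H = {}" | x where "Q \<inter> ?H = {x}"
    | x y where "x \<in> Q \<inter> ?H" "y \<in> Q \<inter> ?H" "x \<noteq> y"
    by (metis is_singletonI' is_singleton_def)
  thus ?thesis
  proof cases
    case 1
    have "Av ?C ?ind w \<le> Av ?C (\<lambda>_. 0) w"
      by (rule Av_mono) (use unanswered 1 in auto)
    thus ?thesis by simp
  next
    case (2 x)
    let ?E = "\<lambda>w'. of_bool ((x, Suc j) \<in> w') :: real"
    have "Av ?C ?ind w \<le> Av ?C ?E w"
    proof (rule Av_mono)
      fix w' assume "w' - ?C = w - ?C"
      from unanswered[OF this] 2 show "?ind w' \<le> ?E w'" by auto
    qed
    also have "\<dots> = Av {(x, Suc j)} ?E w"
    proof (rule Av_subset)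
      show "{(x, Suc j)} \<subseteq> ?C" using coin 2 by auto
    qed auto
    also have "\<dots> = 1 / 2" by (simp add: Av_insert)
    finally show ?thesis by simp
  next
    case (3 x y)
    let ?D = "{(x, 0), (x, Suc j), (y, 0), (y, Suc j)}"
    let ?E = "\<lambda>w'. of_bool (((x, 0) \<in> w' \<or> (x, Suc j) \<in> w') \<and>
                                ((y, 0) \<in> w' \<or> (y, Suc j) \<in> w')) :: real"
    have "Av ?C ?ind w \<le> Av ?C ?E w"
    proof (rule Av_mono)
      fix w' assume "w' - ?C = w - ?C"
      from unanswered[OF this] 3 show "?ind w' \<le> ?E w'" by auto
    qed
    also have "\<dots> = Av ?D ?E w"
    proof (rule Av_subset)
      show "?D \<subseteq> ?C" using coin 3 by auto
      fix w' w'' assume "w'' - (?C - ?D) = w' - (?C - ?D)"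
      from agree_iff[OF this] show "?E w'' = ?E w'" by simp
    qed simp
    also have "\<dots> = 9 / 16" using 3(3) by (simp add: Av_insert)
    finally show ?thesis by simp
  qed
qed

text \<open>Given level \<open>j\<close>, the size of \<open>deep (Suc j) w'\<close> is binomial:
  one fair coin for each point of the latter half.\<close>

lemma Av_inverse_card_deep_le:
  assumes V: "finite V"
  shows "Av (coins V j) (\<lambda>w'. 1 / (real (card (deep (Suc j) w')) + 1)) w
    \<le> 2 / (real (card (latter (deep j w))) + 1)"
proof -
  let ?C = "coins V j" and ?H = "latter (deep j w)"
  let ?D = "?H \<times> {Suc j}"
  let ?F = "\<lambda>w'. 1 / (real (card (deep (Suc j) w')) + 1)"
  have cardD: "card ?D = card ?H" by simp
  have DC: "?D \<subseteq> ?C"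
  proof (intro subsetI)
    fix c assume "c \<in> ?D"
    moreover from this have "fst c \<in> deep j w" using latter_subset[of "deep j w"] by auto
    ultimately show "c \<in> ?C"
      using deep_nonempty_le[of "fst c" j w] deep_subset_J[of j w] by (auto simp: coins_def)
  qed
  have "Av ?C ?F w = Av ?D ?F w"
  proof (rule Av_subset)
    fix w' w'' assume ag: "w' - ?C = w - ?C" and ag': "w'' - (?C - ?D) = w' - (?C - ?D)"
    have deep: "deep j w' = deep j w" using deep_agree[OF ag order_refl] .
    have "w'' - ?C = w - ?C" using ag ag' by blast
    hence deep': "deep j w'' = deep j w" using deep_agree[OF _ order_refl] by blast
    have "(x, Suc j) \<in> w'' \<longleftrightarrow> (x, Suc j) \<in> w'" if "x \<in> ?H" for x
      using that by (intro agree_iff[OF ag']) auto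
    hence "deep (Suc j) w'' = deep (Suc j) w'" by (auto simp: deep deep')
    thus "?F w'' = ?F w'" by simp
  qed (use V DC in auto)
  also have "\<dots> = (\<Sum>B\<in>Pow ?D. 1 / (real (card B) + 1)) / 2 ^ card ?D"
    unfolding Av_def
  proof (rule arg_cong2[where f="(/)", OF sum.cong[OF refl] refl])
    fix B assume B: "B \<in> Pow ?D"
    have "(w - ?D \<union> B) - ?C = w - ?C" using B DC by blast
    hence "deep j (w - ?D \<union> B) = deep j w" using deep_agree[OF _ order_refl] by blast
    hence "deep (Suc j) (w - ?D \<union> B) = fst ` B" using B by force
    moreover have "card (fst ` B) = card B"
      using B by (intro card_image) (auto simp: inj_on_def)
    ultimately show "?F (w - ?D \<union> B) = 1 / (real (card B) + 1)" by simp
  qed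
  also have "\<dots> \<le> (2 ^ card ?D * (2 / (real (card ?D) + 1))) / 2 ^ card ?D"
    by (intro divide_right_mono sum_Pow_inverse_Suc_card_le) simp_all
  finally show ?thesis by (simp add: cardD)
qed

text \<open>Jensen's inequality with the tangent of \<open>ln\<close> at a quarter of the current potential.\<close>

lemma Av_ln_ge:
  fixes G :: nat
  assumes V: "finite V" and r: "card (latter (deep j w)) \<le> r" "r \<le> card (deep j w)"
  shows "ln (real G + real r + 1) - ln 4
    \<le> Av (coins V j) (\<lambda>w'. ln (real G + real (card (deep (Suc j) w')) + 1)) w"
proof -
  let ?C = "coins V j"
  let ?k = "\<lambda>w'. real (card (deep (Suc j) w'))"
  define a where "a = (real G + real r + 1) / 4"
  have a: "a > 0" by (simp add: a_def)
  have h: "real r + 1 \<le> 2 * (real (card (latter (deep j w))) + 1)"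
  proof -
    have "r + 1 \<le> 2 * (card (latter (deep j w)) + 1)"
      using r(2) card_latter[OF deep_subset_J, of j w] by presburger
    from of_nat_mono[OF this, where 'a=real] show ?thesis by simp
  qed
  have pointwise: "(ln a + 1) - (real r + 1) / 4 * (1 / (?k w' + 1)) \<le> ln (real G + ?k w' + 1)"
    if ag: "w' - ?C = w - ?C" for w'
  proof -
    have "card (deep (Suc j) w') \<le> card (latter (deep j w))"
      using deep_Suc_subset_latter[of j w'] deep_agree[OF ag order_refl] by (intro card_mono) auto
    hence "card (deep (Suc j) w') \<le> r" using r(1) by linarith
    hence kr: "?k w' \<le> real r" by simp
    define y where "y = real G + ?k w' + 1"
    have y: "y > 0" by (simp add: y_def add_nonneg_pos)
    have "ln (a / y) \<le> a / y - 1" using a y by (intro ln_le_minus_one) simp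
    hence 1: "ln a + 1 - a / y \<le> ln y" using a y by (simp add: ln_div)
    \<comment> \<open>Adding \<open>G\<close> to numerator and denominator only brings the ratio
      closer to 1, since \<open>?k w' \<le> r\<close>.\<close>
    have "(real G + real r + 1) * (?k w' + 1) \<le> (real r + 1) * y"
    proof -
      have "real G * ?k w' \<le> real G * real r" using kr by (intro mult_left_mono) auto
      thus ?thesis by (simp add: y_def algebra_simps)
    qed
    hence le: "(real G + real r + 1) / y \<le> (real r + 1) / (?k w' + 1)"
      using y by (simp add: divide_simps mult.commute split: if_splits)
    have "a / y = (real G + real r + 1) / y / 4" by (simp add: a_def)
    also have "\<dots> \<le> (real r + 1) / (?k w' + 1) / 4" by (intro divide_right_mono le) simp
    also have "\<dots> = (real r + 1) / 4 * (1 / (?k w' + 1))"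
      by (simp only: times_divide_eq_right mult_1_right divide_divide_eq_left mult.commute)
    finally have "a / y \<le> (real r + 1) / 4 * (1 / (?k w' + 1))" .
    thus ?thesis using 1 by (simp add: y_def)
  qed
  have "(real r + 1) / 4 * Av ?C (\<lambda>w'. 1 / (?k w' + 1)) w
      \<le> (real r + 1) / 4 * (2 / (real (card (latter (deep j w))) + 1))"
    by (intro mult_left_mono Av_inverse_card_deep_le V) simp
  \<comment> \<open>The quarter in \<open>a\<close> makes this mean at most 1, which the
    \<open>+ 1\<close> of the tangent absorbs.\<close>
  also have "\<dots> \<le> 1" using h by (simp add: divide_simps)
  finally have "ln a \<le> (ln a + 1) - (real r + 1) / 4 * Av ?C (\<lambda>w'. 1 / (?k w' + 1)) w" by simp
  also have "\<dots> = Av ?C (\<lambda>w'. (ln a + 1) - (real r + 1) / 4 * (1 / (?k w' + 1))) w"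
    using V by (simp only: Av_diff Av_scale Av_const finite_coins)
  also have "\<dots> \<le> Av ?C (\<lambda>w'. ln (real G + ?k w' + 1)) w"
    by (rule Av_mono) (rule pointwise)
  finally show ?thesis by (simp add: a_def ln_div)
qed

text \<open>The coins in \<open>J \<times> {Suc j}\<close> determine \<open>deep (Suc j) w'\<close>.
  After them, the labels of the points that drop out are revealed as well, and the remaining coins
  form the state at level \<open>Suc j\<close>.\<close>

lemma Av_next_level:
  assumes ne: "deep j w \<noteq> {}"
  shows "Av (coins (deep j w \<inter> Y) j) F w =
    Av (coins (deep j w \<inter> Y) j) (\<lambda>w'. Av (coins (deep (Suc j) w' \<inter> Y) (Suc j)) F w') w"
proof (rule Av_tower[where K = "J \<times> {Suc j}"])
  let ?C = "coins (deep j w \<inter> Y) j"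
  show "finite ?C" by simp
  show "J \<times> {Suc j} \<subseteq> ?C"
    using ne deep_nonempty_le[of "SOME x. x \<in> deep j w" j w] by (auto simp: coins_def some_in_eq)
  fix w' assume "w' - ?C = w - ?C"
  hence "deep j w' = deep j w" using deep_agree[OF _ order_refl] by blast
  hence "deep (Suc j) w' \<subseteq> deep j w" using deep_Suc_subset[of j w'] by simp
  thus "coins (deep (Suc j) w' \<inter> Y) (Suc j) \<subseteq> ?C - J \<times> {Suc j}"
    by (auto simp: coins_def)
next
  fix w1 w2 assume ag: "w1 - (coins (deep j w \<inter> Y) j - J \<times> {Suc j}) = w2 - (coins (deep j w \<inter> Y) j - J \<times> {Suc j})"
  have "deep (Suc j) w1 = deep (Suc j) w2"
    by (intro deep_cong agree_iff[OF ag]) (auto simp: coins_def)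
  thus "coins (deep (Suc j) w1 \<inter> Y) (Suc j) = coins (deep (Suc j) w2 \<inter> Y) (Suc j)" by simp
qed

end

section \<open>The potential argument\<close>

text \<open>The potential \<open>ln (G + r + 1)\<close> is turned into a number of mistakes by the exponential; its
  tangent at \<open>ln c\<close> is used instead, to have a bound that is linear in the numbers of mistakes
  and calls and can be integrated over the learner's randomness.\<close>

definition potential :: "real \<Rightarrow> nat \<Rightarrow> nat \<Rightarrow> real" where
  "potential c G r = c * (ln (real G + real r + 1) - ln c + 1) - 1 - real G"

lemma potential_mono: "c > 0 \<Longrightarrow> r \<le> r' \<Longrightarrow> potential c G r \<le> potential c G r'"
  by (simp add: potential_def)

text \<open>This is \<open>ln x \<le> x - 1\<close> at \<open>x = (G + 1) / c\<close>. It closes a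
  run, where no further cost arises.\<close>

lemma potential_nonpos:
  assumes "c > 0"
  shows "potential c G 0 \<le> 0"
proof -
  have "ln ((real G + 1) / c) \<le> (real G + 1) / c - 1"
    using assms by (intro ln_le_minus_one) simp
  hence "c * ln ((real G + 1) / c) \<le> c * ((real G + 1) / c - 1)"
    using assms by (intro mult_left_mono) auto
  also have "\<dots> = real G + 1 - c" using assms by (simp add: field_simps)
  finally show ?thesis
    using assms by (simp add: potential_def ln_div algebra_simps)
qed

text \<open>A prediction on a fair label moves one point from \<open>r\<close> to \<open>G\<close>;
  the loss of 1 is the mean of twice its mistake indicator.\<close>

lemma potential_guess: "potential c (Suc G) r = potential c G (Suc r) - 1"
  by (simp add: potential_def add_ac)

lemma ln_128: "ln 128 = 7 * ln (2::real)" and ln_4: "ln 4 = 2 * ln (2::real)"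
  using ln_realpow[of 2 7] ln_realpow[of 2 2] by simp_all

text \<open>With \<open>r \<le> G + 1\<close>, giving up all of \<open>r\<close> at most halves
  \<open>G + r + 1\<close>, and \<open>2 \<le> 128\<close>.\<close>

lemma potential_halved:
  assumes "c > 0" "r \<le> Suc G"
  shows "potential c G r - c * ln 128 \<le> potential c G 0"
proof -
  have "ln (real G + real r + 1) \<le> ln (2 * (real G + 1))"
    using assms(2) by (subst ln_le_cancel_iff) auto
  also have "\<dots> = ln 2 + ln (real G + 1)" by (simp only: ln_mult_pos)
  also have "\<dots> \<le> ln 128 + ln (real G + 1)" by simp
  finally have "c * ln (real G + real r + 1) \<le> c * (ln 128 + ln (real G + 1))"
    using assms(1) by (intro mult_left_mono) auto
  thus ?thesis by (simp add: potential_def algebra_simps)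
qed

context layered_orders
begin

section \<open>Loss of potential in one query\<close>

declare deep.simps(2) [simp del]

text \<open>\<open>Q\<close> is the positive part of a query, \<open>F\<close> the cost after its
  answer, and \<open>answered\<close> the bound supplied by the continuation once the top of
  \<open>Q\<close> has been placed. The lemmas below reveal levels until that happens.\<close>

context
  fixes c :: real and Q :: "'a set" and zs ys :: "'a list" and F :: "('a \<times> nat) set \<Rightarrow> real"
  assumes c: "c > 0" and Q: "Q \<subseteq> X" "Q \<noteq> {}" and xs_eq: "xs = zs @ ys"
    and answered: "\<And>j w G. top_of w Q \<notin> deep j w \<Longrightarrow> card (deep j w - set ys) \<le> G \<Longrightarrow>
      potential c G (card (deep j w \<inter> set ys)) \<le> Av (coins (deep j w \<inter> set ys) j) F w"
begin

lemma card_seen_deep_Suc: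
  assumes "card (deep j w - set ys) \<le> G" "w' - coins (deep j w \<inter> set ys) j = w - coins (deep j w \<inter> set ys) j"
  shows "card (deep (Suc j) w' - set ys) \<le> G"
proof -
  have "deep (Suc j) w' \<subseteq> deep j w"
    using deep_Suc_subset[of j w'] deep_agree[OF assms(2) order_refl] by simp
  hence "card (deep (Suc j) w' - set ys) \<le> card (deep j w - set ys)"
    by (intro card_mono) auto
  thus ?thesis using assms(1) by simp
qed

text \<open>\<open>potential c G 0\<close> ignores the remaining points, so it survives the
  revealing of levels unchanged until the top of \<open>Q\<close> has been placed.\<close>

lemma query_ge_spent:
  "card (deep j w - set ys) \<le> G \<Longrightarrow>
    potential c G 0 \<le> Av (coins (deep j w \<inter> set ys) j) F w"
proof (induction "card J - j" arbitrary: j w rule: less_induct)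
  case less
  let ?C = "coins (deep j w \<inter> set ys) j"
  show ?case
  proof (cases "top_of w Q \<in> deep j w")
    case False
    have "potential c G 0 \<le> potential c G (card (deep j w \<inter> set ys))"
      using c by (intro potential_mono) auto
    also have "\<dots> \<le> Av ?C F w" by (rule answered[OF False less.prems])
    finally show ?thesis .
  next
    case True
    have dec: "card J - Suc j < card J - j" using deep_nonempty_le[OF True] by simp
    have "potential c G 0 = Av ?C (\<lambda>_. potential c G 0) w" by simp
    also have "\<dots> \<le> Av ?C (\<lambda>w'. Av (coins (deep (Suc j) w' \<inter> set ys) (Suc j)) F w') w"
      by (intro Av_mono less.hyps[OF dec] card_seen_deep_Suc[OF less.prems])
    also have "\<dots> = Av ?C F w"
      by (rule Av_next_level[symmetric]) (use True in auto)
    finally show ?thesis .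
  qed
qed

text \<open>By \<open>Av_ln_ge\<close> a revealed level costs at most a factor 4, and
  \<open>e\<close> is paid only when the query remains unanswered. Freshness of the latter half lets
  all of \<open>deep (Suc j) w'\<close> count in the new potential.\<close>

lemma query_level_step:
  fixes G :: nat
  assumes ne: "deep j w \<noteq> {}" and fresh: "latter (deep j w) \<subseteq> set ys"
    and e: "e \<ge> 0"
    and next_level: "\<And>w'. w' - coins (deep j w \<inter> set ys) j = w - coins (deep j w \<inter> set ys) j \<Longrightarrow>
      potential c G (card (deep (Suc j) w' \<inter> set ys)) - e * of_bool (top_of w' Q \<in> deep (Suc j) w')
        \<le> Av (coins (deep (Suc j) w' \<inter> set ys) (Suc j)) F w'"
  shows "potential c G (card (deep j w \<inter> set ys)) - c * ln 4
      - e * Av (coins (deep j w \<inter> set ys) j) (\<lambda>w'. of_bool (top_of w' Q \<in> deep (Suc j) w')) w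
    \<le> Av (coins (deep j w \<inter> set ys) j) F w"
proof -
  let ?C = "coins (deep j w \<inter> set ys) j"
  let ?r = "card (deep j w \<inter> set ys)"
  let ?ind = "\<lambda>w'. of_bool (top_of w' Q \<in> deep (Suc j) w') :: real"
  let ?L = "\<lambda>w'. ln (real G + real (card (deep (Suc j) w')) + 1)"
  let ?b = "c * (1 - ln c) - 1 - real G"
  have r: "card (latter (deep j w)) \<le> ?r" "?r \<le> card (deep j w)"
    using fresh latter_subset[of "deep j w"] by (auto intro!: card_mono)
  have "c * (ln (real G + real ?r + 1) - ln 4) + ?b - e * Av ?C ?ind w
      \<le> c * Av ?C ?L w + ?b - e * Av ?C ?ind w"
    using c by (intro diff_right_mono add_right_mono mult_left_mono Av_ln_ge r) auto
  also have "\<dots> = Av ?C (\<lambda>w'. c * ?L w' + ?b - e * ?ind w') w"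
    by (simp only: Av_diff Av_add Av_scale Av_const finite_coins finite_Int finite_deep simp_thms)
  also have "\<dots> \<le> Av ?C (\<lambda>w'. Av (coins (deep (Suc j) w' \<inter> set ys) (Suc j)) F w') w"
  proof (rule Av_mono)
    fix w' assume ag: "w' - ?C = w - ?C"
    have "deep (Suc j) w' \<subseteq> set ys"
      using fresh deep_Suc_subset_latter[of j w'] deep_agree[OF ag order_refl] by (simp only: order.trans)
    hence "deep (Suc j) w' \<inter> set ys = deep (Suc j) w'" by blast
    thus "c * ?L w' + ?b - e * ?ind w' \<le> Av (coins (deep (Suc j) w' \<inter> set ys) (Suc j)) F w'"
      using next_level[OF ag] by (simp only: potential_def) (simp add: algebra_simps)
  qed
  also have "\<dots> = Av ?C F w"
    by (rule Av_next_level[symmetric, OF ne])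
  finally show ?thesis by (simp add: potential_def algebra_simps)
qed

text \<open>The constant solves \<open>e = c ln 4 + 9/16 e\<close>.\<close>

lemma query_ge_fresh:
  "deep j w \<subseteq> set ys \<Longrightarrow>
    potential c G (card (deep j w \<inter> set ys)) - 16 / 7 * (c * ln 4) \<le> Av (coins (deep j w \<inter> set ys) j) F w"
proof (induction "card J - j" arbitrary: j w rule: less_induct)
  case less
  let ?C = "coins (deep j w \<inter> set ys) j"
  let ?e = "16 / 7 * (c * ln 4)"
  have e: "?e \<ge> 0" using c by simp
  show ?case
  proof (cases "top_of w Q \<in> deep j w")
    case False
    have "deep j w - set ys = {}" using less.prems by blast
    hence "potential c G (card (deep j w \<inter> set ys)) \<le> Av ?C F w"
      by (intro answered[OF False]) (simp only: card.empty le0)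
    thus ?thesis using e by linarith
  next
    case True
    have dec: "card J - Suc j < card J - j" using deep_nonempty_le[OF True] by simp
    have "potential c G (card (deep j w \<inter> set ys)) - c * ln 4
        - ?e * Av ?C (\<lambda>w'. of_bool (top_of w' Q \<in> deep (Suc j) w')) w \<le> Av ?C F w"
    proof (rule query_level_step[OF _ _ e])
      show "deep j w \<noteq> {}" using True by auto
      show "latter (deep j w) \<subseteq> set ys" using less.prems latter_subset by blast
      fix w' assume ag: "w' - ?C = w - ?C"
      have fresh: "deep (Suc j) w' \<subseteq> set ys"
        using less.prems deep_Suc_subset[of j w'] deep_agree[OF ag order_refl] by simp
      show "potential c G (card (deep (Suc j) w' \<inter> set ys)) - ?e * of_bool (top_of w' Q \<in> deep (Suc j) w')
        \<le> Av (coins (deep (Suc j) w' \<inter> set ys) (Suc j)) F w'"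
      proof (cases "top_of w' Q \<in> deep (Suc j) w'")
        case True
        thus ?thesis using less.hyps[OF dec fresh] by simp
      next
        case False
        have "deep (Suc j) w' - set ys = {}" using fresh by blast
        hence "card (deep (Suc j) w' - set ys) \<le> G" by (simp only: card.empty le0)
        thus ?thesis using answered[OF False] False by simp
      qed
    qed
    moreover have "Av ?C (\<lambda>w'. of_bool (top_of w' Q \<in> deep (Suc j) w')) w \<le> 9 / 16"
    proof -
      have "deep j w \<inter> set ys = deep j w" using less.prems by blast
      thus ?thesis using Av_unanswered_le[OF Q, of j w] by simp
    qed
    hence "?e * Av ?C (\<lambda>w'. of_bool (top_of w' Q \<in> deep (Suc j) w')) w \<le> ?e * (9 / 16)"
      by (intro mult_left_mono e)
    ultimately show ?thesis by linarith
  qed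
qed

text \<open>If the latter half is fresh, the current level costs \<open>ln 4\<close> and the inner
  ones \<open>16 / 7 * ln 4\<close>, in total \<open>46 / 7 * ln 2\<close>, below
  \<open>ln 128 = 7 * ln 2\<close>. Otherwise at least half of the unplaced points have arrived and
  the rest can be given up.\<close>

lemma query_ge:
  assumes G: "card (deep j w - set ys) \<le> G"
  shows "potential c G (card (deep j w \<inter> set ys)) - c * ln 128 \<le> Av (coins (deep j w \<inter> set ys) j) F w"
proof (cases "top_of w Q \<in> deep j w")
  case False
  have "c * ln 128 \<ge> 0" using c by simp
  thus ?thesis using answered[OF False G] by linarith
next
  case top: True
  let ?C = "coins (deep j w \<inter> set ys) j"
  let ?e = "16 / 7 * (c * ln 4)"
  have e: "?e \<ge> 0" using c by simp
  from latter_fresh_or_half_seen[OF deep_subset_J xs_eq, of j w] show ?thesis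
  proof
    assume fresh: "latter (deep j w) \<subseteq> set ys"
    have "potential c G (card (deep j w \<inter> set ys)) - c * ln 4
        - ?e * Av ?C (\<lambda>w'. of_bool (top_of w' Q \<in> deep (Suc j) w')) w \<le> Av ?C F w"
    proof (rule query_level_step[OF _ fresh e])
      show "deep j w \<noteq> {}" using top by auto
      fix w' assume ag: "w' - ?C = w - ?C"
      have fresh': "deep (Suc j) w' \<subseteq> set ys"
        using fresh deep_Suc_subset_latter[of j w'] deep_agree[OF ag order_refl] by (simp only: order.trans)
      show "potential c G (card (deep (Suc j) w' \<inter> set ys)) - ?e * of_bool (top_of w' Q \<in> deep (Suc j) w')
        \<le> Av (coins (deep (Suc j) w' \<inter> set ys) (Suc j)) F w'"
      proof (cases "top_of w' Q \<in> deep (Suc j) w'")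
        case True
        thus ?thesis using query_ge_fresh[OF fresh', of G] by simp
      next
        case False
        thus ?thesis using answered[OF False card_seen_deep_Suc[OF G ag]] by simp
      qed
    qed
    \<comment> \<open>Some labels in the former half may be known here, while the bound
      \<open>9 / 16\<close> is stated for unknown ones; the trivial bound is used on this
      level.\<close>
    moreover have "Av ?C (\<lambda>w'. of_bool (top_of w' Q \<in> deep (Suc j) w')) w \<le> Av ?C (\<lambda>_. 1) w"
      by (rule Av_mono) simp
    hence "?e * Av ?C (\<lambda>w'. of_bool (top_of w' Q \<in> deep (Suc j) w')) w \<le> ?e * 1"
      by (intro mult_left_mono e) simp
    moreover have "c * ln 4 + ?e \<le> c * ln 128"
      using c by (simp add: ln_4 ln_128)
    ultimately show ?thesis by linarith
  next
    assume half: "card (deep j w) \<le> 2 * card (deep j w - set ys)"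
    have "card (deep j w) = card (deep j w \<inter> set ys) + card (deep j w - set ys)"
      by (metis card_Int_Diff finite_deep)
    hence "card (deep j w \<inter> set ys) \<le> Suc G" using half G by linarith
    hence "potential c G (card (deep j w \<inter> set ys)) - c * ln 128 \<le> potential c G 0"
      by (rule potential_halved[OF c])
    also have "\<dots> \<le> Av ?C F w" by (rule query_ge_spent[OF G])
    finally show ?thesis .
  qed
qed

end

text \<open>A mistake weighs 2, so that guessing a fair label costs 1 on average; a call is charged
  the loss allowed by \<open>query_ge\<close>.\<close>

definition cost :: "real \<Rightarrow> ('a \<times> nat) set \<Rightarrow> 'a learner \<Rightarrow> 'a list \<Rightarrow> real" where
  "cost c w A ys =
     2 * real (run_mistakes (oracle_min X (ord w)) A (map (prefix_concept (ord w) (target w)) ys))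
     + c * ln 128 * real (run_calls (oracle_min X (ord w)) A (map (prefix_concept (ord w) (target w)) ys))"

lemma cost_Ask: "cost c w (Ask S k) ys = c * ln 128 + cost c w (k (oracle_min X (ord w) S)) ys"
  by (simp add: cost_def algebra_simps)

lemma cost_Guess:
  "cost c w (Guess b k) (x # ys) =
     2 * of_bool (b \<noteq> prefix_concept (ord w) (target w) x)
     + cost c w (k (prefix_concept (ord w) (target w) x)) ys"
  by (simp add: cost_def)

text \<open>The history is summarized by \<open>j\<close> and \<open>w\<close>, with the coins of
  the average still unknown. \<open>G\<close> only has to dominate the number of arrived unplaced
  points, a condition that persists when further levels are revealed.\<close>

lemma Av_cost_ge:
  assumes c: "c > 0"
  shows "legal X A (length ys) \<Longrightarrow> xs = zs @ ys \<Longrightarrow> card (deep j w - set ys) \<le> G \<Longrightarrow>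
    potential c G (card (deep j w \<inter> set ys)) \<le> Av (coins (deep j w \<inter> set ys) j) (\<lambda>w'. cost c w' A ys) w"
proof (induction A arbitrary: zs ys j w G)
  case (Ask S k)
  let ?C = "coins (deep j w \<inter> set ys) j"
  have S: "S \<subseteq> X \<times> UNIV" and legal: "\<And>a. legal X (k a) (length ys)"
    using Ask.prems(1) by auto
  let ?F = "\<lambda>w'. cost c w' (k (oracle_min X (ord w') S)) ys"
  have "potential c G (card (deep j w \<inter> set ys)) - c * ln 128 \<le> Av ?C ?F w"
  proof (rule query_ge[OF c required_props(1)[OF S] required_props(3)[OF S] Ask.prems(2) _ Ask.prems(3)])
    fix j w G assume top: "top_of w (required S) \<notin> deep j w" and G: "card (deep j w - set ys) \<le> G"
    let ?D = "coins (deep j w \<inter> set ys) j"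
    have "potential c G (card (deep j w \<inter> set ys))
        \<le> Av ?D (\<lambda>w'. cost c w' (k (oracle_min X (ord w) S)) ys) w"
      by (rule Ask.IH[OF rangeI legal Ask.prems(2) G])
    \<comment> \<open>The top has been placed, so the answer is the same for all remaining outcomes
      and the continuation is a fixed learner.\<close>
    also have "\<dots> = Av ?D ?F w"
    proof (rule Av_cong)
      fix w' assume "w' - ?D = w - ?D"
      from oracle_agree[OF this _ S top]
      show "cost c w' (k (oracle_min X (ord w) S)) ys = ?F w'" by simp
    qed
    finally show "potential c G (card (deep j w \<inter> set ys)) \<le> Av ?D ?F w" .
  qed
  thus ?case by (simp add: cost_Ask Av_add)
next
  case (Guess b k)
  obtain x ys' where ys: "ys = x # ys'" using Guess.prems(1) by (cases ys) auto
  have legal: "\<And>y. legal X (k y) (length ys')" using Guess.prems(1) ys by auto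
  have xs': "xs = (zs @ [x]) @ ys'" using Guess.prems(2) ys by simp
  have x_xs: "x \<in> set xs" and x1: "x \<notin> set ys'" using distinct_xs by (simp_all add: xs')
  have x: "x \<notin> set ys'" "x \<in> X" using x1 x_xs by (simp_all add: X_def)
  note label = prefix_target[OF x(2)]
  have IH: "potential c G' (card (deep j v \<inter> set ys'))
      \<le> Av (coins (deep j v \<inter> set ys') j) (\<lambda>w'. cost c w' (k y) ys') v"
    if "card (deep j v - set ys') \<le> G'" for v G' y
    by (rule Guess.IH[OF rangeI legal xs' that])
  let ?C = "coins (deep j w \<inter> set ys) j" and ?C' = "coins (deep j w \<inter> set ys') j"
  show ?case
  proof (cases "x \<in> deep j w")
    \<comment> \<open>The label of \<open>x\<close> is already determined, so the prediction changes
      neither \<open>G\<close> nor \<open>r\<close>.\<close>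
    case False
    hence eqs: "deep j w \<inter> set ys = deep j w \<inter> set ys'" "deep j w - set ys = deep j w - set ys'"
      using ys by auto
    define y where "y = prefix_concept (ord w) (target w) x"
    have y: "prefix_concept (ord w') (target w') x = y" if ag: "w' - ?C = w - ?C" for w'
      using False unfolding y_def label
      by (intro arg_cong2[where f="(\<or>)"] refl agree_iff[OF ag]) (auto simp: coins_def)
    have "potential c G (card (deep j w \<inter> set ys)) \<le> Av ?C (\<lambda>w'. cost c w' (k y) ys') w"
      using IH[of w G y] Guess.prems(3) by (simp only: eqs)
    also have "\<dots> \<le> Av ?C (\<lambda>w'. cost c w' (Guess b k) ys) w"
      by (rule Av_mono) (simp add: ys cost_Guess y[unfolded ys])
    finally show ?thesis .
  next
    case True
    have "x \<noteq> s" using True deep_subset_J s_notin_J by blast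
    have C: "?C = insert (x, 0) ?C'" "(x, 0) \<notin> ?C'"
      using True ys x(1) by (auto simp: coins_def)
    have r: "card (deep j w \<inter> set ys) = Suc (card (deep j w \<inter> set ys'))"
    proof -
      have "deep j w \<inter> set ys = insert x (deep j w \<inter> set ys')" using True ys by auto
      thus ?thesis using x(1) by simp
    qed
    have G: "card (deep j w - set ys') \<le> Suc G"
    proof -
      have eq: "deep j w - set ys' = insert x (deep j w - set ys)" using True ys x(1) by auto
      have "card (insert x (deep j w - set ys)) \<le> Suc (card (deep j w - set ys))"
        by (simp add: card_insert_if)
      thus ?thesis unfolding eq using Guess.prems(3) by linarith
    qed
    have branch: "potential c (Suc G) (card (deep j w \<inter> set ys')) + 2 * of_bool (b \<noteq> y)
        \<le> Av ?C' (\<lambda>w'. cost c w' (Guess b k) ys) v"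
      if v: "deep j v = deep j w" "(x, 0) \<in> v \<longleftrightarrow> y" for v y
    proof -
      have "Av ?C' (\<lambda>w'. cost c w' (Guess b k) ys) v
          = Av ?C' (\<lambda>w'. 2 * of_bool (b \<noteq> y) + cost c w' (k y) ys') v"
      proof (rule Av_cong)
        fix w' assume "w' - ?C' = v - ?C'"
        from agree_iff[OF this C(2)] v(2) \<open>x \<noteq> s\<close>
        show "cost c w' (Guess b k) ys = 2 * of_bool (b \<noteq> y) + cost c w' (k y) ys'"
          by (simp add: ys cost_Guess label)
      qed
      also have "\<dots> = 2 * of_bool (b \<noteq> y) + Av ?C' (\<lambda>w'. cost c w' (k y) ys') v"
        by (simp only: Av_add Av_const finite_coins finite_Int finite_deep simp_thms)
      finally show ?thesis using IH[of v "Suc G" y] G v(1) by simp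
    qed
    have deep: "deep j (insert (x, 0) w) = deep j w" "deep j (w - {(x, 0)}) = deep j w"
      by (intro deep_cong; simp)+
    \<comment> \<open>Exactly one value of the label contradicts \<open>b\<close>, so the two
      mistake terms average to 1.\<close>
    have "potential c G (card (deep j w \<inter> set ys))
        = ((potential c (Suc G) (card (deep j w \<inter> set ys')) + 2 * of_bool (b \<noteq> True))
          + (potential c (Suc G) (card (deep j w \<inter> set ys')) + 2 * of_bool (b \<noteq> False))) / 2"
      by (cases b) (simp_all add: r potential_guess)
    also have "\<dots> \<le> (Av ?C' (\<lambda>w'. cost c w' (Guess b k) ys) (insert (x, 0) w)
        + Av ?C' (\<lambda>w'. cost c w' (Guess b k) ys) (w - {(x, 0)})) / 2"
      by (intro divide_right_mono add_mono branch deep) auto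
    also have "\<dots> = Av ?C (\<lambda>w'. cost c w' (Guess b k) ys) w"
      unfolding C(1) by (rule Av_insert[symmetric]) (use C(2) in auto)
    finally show ?thesis .
  qed
next
  case Halt
  hence ys: "ys = []" by simp
  show ?case using potential_nonpos[OF c, of G] by (simp add: cost_def ys)
qed

section \<open>The hard distribution\<close>

definition problem_of :: "('a \<times> nat) set \<Rightarrow> 'a rel \<times> 'a" where
  "problem_of w = (ord w, target w)"

text \<open>Uniform over the outcomes of all coins rather than over problems, as different outcomes
  may give the same order and target.\<close>

definition hard_problem :: "('a rel \<times> 'a) pmf" where
  "hard_problem = map_pmf problem_of (pmf_of_set (Pow (coins J 0)))"

lemma Pow_coins [simp]: "finite (Pow (coins J 0))" "Pow (coins J 0) \<noteq> {}"
  by auto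

lemma set_hard_problem: "set_pmf hard_problem = problem_of ` Pow (coins J 0)"
  by (simp add: hard_problem_def)

lemma expectation_hard_problem:
  "measure_pmf.expectation hard_problem (f :: _ \<Rightarrow> real) =
    (\<Sum>w\<in>Pow (coins J 0). f (problem_of w)) / 2 ^ card (coins J 0)"
  by (simp add: hard_problem_def integral_pmf_of_set card_Pow)

lemma nn_integral_hard_problem:
  "(\<integral>\<^sup>+p. f p \<partial>measure_pmf hard_problem) =
    (\<Sum>w\<in>Pow (coins J 0). f (problem_of w)) / ennreal (2 ^ card (coins J 0))"
  by (simp add: hard_problem_def nn_integral_pmf_of_set card_Pow)
    (simp add: ennreal_power[symmetric])

lemma deterministic_bound:
  assumes "c > 0" "legal X A (length xs)"
  shows "potential c 0 (card J) \<le> (\<Sum>w\<in>Pow (coins J 0). cost c w A xs) / 2 ^ card (coins J 0)"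
proof -
  have "J \<inter> set xs = J" "J - set xs = {}" using J_subset_xs by auto
  thus ?thesis
    using Av_cost_ge[OF assms(1,2), of "[]" 0 "{}" 0] by (simp add: Av_def)
qed

end

section \<open>Randomized learners\<close>

lemma run_mistakes_le: "legal Z A (length ys) \<Longrightarrow> run_mistakes orc A ys \<le> length ys"
proof (induction A arbitrary: ys)
  case (Guess b k)
  then obtain y ys' where "ys = y # ys'" by (cases ys) auto
  moreover have "run_mistakes orc (k y) ys' \<le> length ys'"
    using Guess calculation by auto
  ultimately show ?case by simp
qed auto

context layered_orders
begin

section \<open>Integration over the private bits\<close>

context
  fixes conv :: "'a convention" and R L
  assumes points: "points conv (set xs) = X"
    and adm: "\<And>w. admissible conv (set xs) (ord w)"
    and learner: "randomized_learner conv xs R L"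
begin

lemma problem_of_in_problems: "problem_of w \<in> problems conv (set xs)"
  using adm target_in_X by (simp add: problem_of_def problems_def points)

lemma prob_R: "prob_space R"
  using learner by (simp add: randomized_learner_def)

lemma legal_L: "\<omega> \<in> space R \<Longrightarrow> legal X (L \<omega>) (length xs)"
  using learner by (simp add: randomized_learner_def points)

lemma measurable_costs:
  "(\<lambda>\<omega>. real (mistakes conv xs (L \<omega>) (problem_of w))) \<in> borel_measurable R"
  "(\<lambda>\<omega>. real (oracle_calls conv xs (L \<omega>) (problem_of w))) \<in> borel_measurable R"
proof -
  have "(\<lambda>\<omega>. mistakes conv xs (L \<omega>) (problem_of w)) \<in> measurable R (count_space UNIV)"
    "(\<lambda>\<omega>. oracle_calls conv xs (L \<omega>) (problem_of w)) \<in> measurable R (count_space UNIV)"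
    using learner problem_of_in_problems by (auto simp: randomized_learner_def)
  thus "(\<lambda>\<omega>. real (mistakes conv xs (L \<omega>) (problem_of w))) \<in> borel_measurable R"
    "(\<lambda>\<omega>. real (oracle_calls conv xs (L \<omega>) (problem_of w))) \<in> borel_measurable R"
    by measurable
qed

lemma integrable_mistakes: "integrable R (\<lambda>\<omega>. real (mistakes conv xs (L \<omega>) (problem_of w)))"
proof -
  interpret prob_space R by (rule prob_R)
  have "mistakes conv xs (L \<omega>) (problem_of w) \<le> length xs" if "\<omega> \<in> space R" for \<omega>
    using run_mistakes_le[of X "L \<omega>" "map (prefix_concept (ord w) (target w)) xs"] legal_L[OF that]
    by (simp add: mistakes_def problem_of_def)
  thus ?thesis
    by (intro integrable_const_bound[where B = "real (length xs)"] measurable_costs) auto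
qed

lemma mean_mistakes_nonneg: "mean_mistakes conv xs hard_problem R L \<ge> 0"
  unfolding mean_mistakes_def expectation_hard_problem expected_mistakes_def
  by (intro divide_nonneg_nonneg sum_nonneg integral_nonneg) auto

lemma cost_problem_of:
  "cost c w A xs = 2 * real (mistakes conv xs A (problem_of w))
     + c * ln 128 * real (oracle_calls conv xs A (problem_of w))"
  by (simp add: cost_def mistakes_def oracle_calls_def problem_of_def points)

lemma mean_mistakes_ge:
  "mean_mistakes conv xs hard_problem R L
    \<ge> ((real (card J) + 1) * pow128_neg (mean_calls conv xs hard_problem R L) - 1) / 2"
proof (cases "mean_calls conv xs hard_problem R L = \<infinity>")
  \<comment> \<open>The claimed bound is then \<open>-1 / 2\<close>.\<close>
  case True
  thus ?thesis using mean_mistakes_nonneg by (simp add: pow128_neg_def)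
next
  case False
  interpret prob_space R by (rule prob_R)
  let ?P = "Pow (coins J 0)" and ?N = "2 ^ card (coins J 0) :: real"
  let ?calls = "\<lambda>w \<omega>. real (oracle_calls conv xs (L \<omega>) (problem_of w))"
  let ?mist = "\<lambda>w \<omega>. real (mistakes conv xs (L \<omega>) (problem_of w))"
  have calls_eq: "expected_calls conv xs R L (problem_of w) = (\<integral>\<^sup>+\<omega>. ennreal (?calls w \<omega>) \<partial>R)" for w
    by (simp add: expected_calls_def ennreal_of_nat_eq_real_of_nat)
  \<comment> \<open>A finite average of nonnegative terms with positive weights is finite only if
    every term is.\<close>
  have fin: "integrable R (?calls w)" if w: "w \<in> ?P" for w
  proof -
    have "(\<Sum>w\<in>?P. expected_calls conv xs R L (problem_of w)) \<noteq> \<infinity>"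
    proof
      assume top: "(\<Sum>w\<in>?P. expected_calls conv xs R L (problem_of w)) = \<infinity>"
      have "mean_calls conv xs hard_problem R L = \<infinity>"
        by (simp only: mean_calls_def nn_integral_hard_problem top) (simp add: ennreal_top_divide)
      thus False using False by simp
    qed
    hence "(\<Sum>w\<in>?P. expected_calls conv xs R L (problem_of w)) < \<infinity>"
      by (simp only: infinity_ennreal_def less_top)
    moreover have "expected_calls conv xs R L (problem_of w)
        \<le> (\<Sum>w\<in>?P. expected_calls conv xs R L (problem_of w))"
      by (rule member_le_sum[OF w]) auto
    ultimately have "expected_calls conv xs R L (problem_of w) < \<infinity>"
      by (rule order.strict_trans1[rotated])
    hence "(\<integral>\<^sup>+\<omega>. ennreal (?calls w \<omega>) \<partial>R) < \<infinity>" by (simp only: calls_eq)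
    thus ?thesis by (intro integrableI_nonneg measurable_costs) auto
  qed
  define q where "q = (\<Sum>w\<in>?P. \<integral>\<omega>. ?calls w \<omega> \<partial>R) / ?N"
  have q0: "q \<ge> 0" unfolding q_def by (intro divide_nonneg_nonneg sum_nonneg integral_nonneg) auto
  have "mean_calls conv xs hard_problem R L
      = (\<Sum>w\<in>?P. ennreal (\<integral>\<omega>. ?calls w \<omega> \<partial>R)) / ennreal ?N"
    unfolding mean_calls_def nn_integral_hard_problem calls_eq
    by (intro arg_cong2[where f="(/)"] refl sum.cong nn_integral_eq_integral fin) auto
  also have "\<dots> = ennreal q"
    unfolding q_def by (subst sum_ennreal) (auto intro!: divide_ennreal sum_nonneg)
  finally have calls_q: "mean_calls conv xs hard_problem R L = ennreal q" .
  define \<mu> where "\<mu> = mean_mistakes conv xs hard_problem R L"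
  have \<mu>0: "\<mu> \<ge> 0" unfolding \<mu>_def by (rule mean_mistakes_nonneg)
  have \<mu>_eq: "\<mu> = (\<Sum>w\<in>?P. \<integral>\<omega>. ?mist w \<omega> \<partial>R) / ?N"
    by (simp add: \<mu>_def mean_mistakes_def expectation_hard_problem expected_mistakes_def)
  \<comment> \<open>With this tangent point \<open>2 * \<mu> = c - 1\<close>, so the mistake terms
    cancel and only \<open>ln (card J + 1) - ln 128 * q \<le> ln c\<close> remains.\<close>
  define c where "c = 2 * \<mu> + 1"
  have c: "c > 0" using \<mu>0 by (simp add: c_def)
  have int: "integrable R (\<lambda>\<omega>. 2 * ?mist w \<omega> + c * ln 128 * ?calls w \<omega>)" if "w \<in> ?P" for w
    using fin[OF that] integrable_mistakes by auto
  have "potential c 0 (card J) \<le> (\<integral>\<omega>. (\<Sum>w\<in>?P. 2 * ?mist w \<omega> + c * ln 128 * ?calls w \<omega>) / ?N \<partial>R)"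
  proof (rule integral_ge_const)
    show "integrable R (\<lambda>\<omega>. (\<Sum>w\<in>?P. 2 * ?mist w \<omega> + c * ln 128 * ?calls w \<omega>) / ?N)"
      by (intro integrable_divide_zero Bochner_Integration.integrable_sum int)
    show "AE \<omega> in R. potential c 0 (card J) \<le> (\<Sum>w\<in>?P. 2 * ?mist w \<omega> + c * ln 128 * ?calls w \<omega>) / ?N"
    proof (rule AE_I2)
      fix \<omega> assume "\<omega> \<in> space R"
      from deterministic_bound[OF c legal_L[OF this]]
      show "potential c 0 (card J) \<le> (\<Sum>w\<in>?P. 2 * ?mist w \<omega> + c * ln 128 * ?calls w \<omega>) / ?N"
        by (simp only: cost_problem_of)
    qed
  qed
  also have "\<dots> = (\<Sum>w\<in>?P. \<integral>\<omega>. 2 * ?mist w \<omega> + c * ln 128 * ?calls w \<omega> \<partial>R) / ?N"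
    by (simp only: integral_divide_zero Bochner_Integration.integral_sum[OF int])
  also have "\<dots> = (\<Sum>w\<in>?P. 2 * (\<integral>\<omega>. ?mist w \<omega> \<partial>R) + c * ln 128 * (\<integral>\<omega>. ?calls w \<omega> \<partial>R)) / ?N"
  proof (rule arg_cong2[where f="(/)", OF sum.cong[OF refl] refl])
    fix w assume "w \<in> ?P"
    thus "(\<integral>\<omega>. 2 * ?mist w \<omega> + c * ln 128 * ?calls w \<omega> \<partial>R)
        = 2 * (\<integral>\<omega>. ?mist w \<omega> \<partial>R) + c * ln 128 * (\<integral>\<omega>. ?calls w \<omega> \<partial>R)"
      using fin[of w] integrable_mistakes[of w] by (subst Bochner_Integration.integral_add) auto
  qed
  also have "\<dots> = 2 * \<mu> + c * ln 128 * q"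
    by (simp add: \<mu>_eq q_def sum.distrib sum_distrib_left[symmetric] add_divide_distrib)
  finally have "c * (ln (real (card J) + 1) - ln c + 1) - 1 \<le> (c - 1) + c * ln 128 * q"
    by (simp add: potential_def c_def)
  hence "c * (ln (real (card J) + 1) - ln 128 * q) \<le> c * ln c"
    by (simp add: algebra_simps)
  hence "ln (real (card J) + 1) - ln 128 * q \<le> ln c"
    using c by simp
  hence "exp (ln (real (card J) + 1) - ln 128 * q) \<le> c"
    using c by (metis exp_le_cancel_iff exp_ln)
  moreover have "exp (ln (real (card J) + 1) - ln 128 * q) = (real (card J) + 1) * 128 powr (- q)"
    by (simp add: exp_diff powr_def exp_minus divide_inverse mult.commute)
  ultimately have "(real (card J) + 1) * 128 powr (- q) \<le> 2 * \<mu> + 1"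
    by (simp add: c_def)
  thus ?thesis using q0 by (simp add: pow128_neg_def calls_q \<mu>_def[symmetric])
qed

lemma mean_mistakes_ge_of_calls_le:
  assumes "q \<ge> 0" "mean_calls conv xs hard_problem R L \<le> ennreal q"
  shows "mean_mistakes conv xs hard_problem R L
    \<ge> max 0 (((real (card J) + 1) * 128 powr (- q) - 1) / 2)"
proof -
  have fin: "mean_calls conv xs hard_problem R L \<noteq> \<infinity>"
    using assms(2) by (auto simp: top_unique)
  have "enn2real (mean_calls conv xs hard_problem R L) \<le> q"
    using assms by (simp add: enn2real_leI)
  hence "128 powr (- q) \<le> pow128_neg (mean_calls conv xs hard_problem R L)"
    using fin by (simp add: pow128_neg_def)
  hence "((real (card J) + 1) * 128 powr (- q) - 1) / 2
      \<le> ((real (card J) + 1) * pow128_neg (mean_calls conv xs hard_problem R L) - 1) / 2"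
    by (intro divide_right_mono diff_right_mono mult_left_mono) auto
  also note mean_mistakes_ge
  finally show ?thesis using mean_mistakes_nonneg by (rule max.boundedI[rotated])
qed

lemma mean_calls_le_of_AE:
  assumes "q \<ge> 0"
    and "AE p in measure_pmf hard_problem. AE \<omega> in R. real (oracle_calls conv xs (L \<omega>) p) \<le> q"
  shows "mean_calls conv xs hard_problem R L \<le> ennreal q"
proof -
  interpret R: prob_space R by (rule prob_R)
  have "AE p in measure_pmf hard_problem. expected_calls conv xs R L p \<le> ennreal q"
    using assms(2)
  proof (rule AE_mp, intro AE_I2 impI)
    fix p assume "AE \<omega> in R. real (oracle_calls conv xs (L \<omega>) p) \<le> q"
    hence "expected_calls conv xs R L p \<le> (\<integral>\<^sup>+\<omega>. ennreal q \<partial>R)"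
      unfolding expected_calls_def
      by (intro nn_integral_mono_AE) (auto simp: ennreal_of_nat_eq_real_of_nat elim!: AE_mp)
    thus "expected_calls conv xs R L p \<le> ennreal q"
      by (simp add: R.emeasure_space_1)
  qed
  hence "mean_calls conv xs hard_problem R L \<le> (\<integral>\<^sup>+p. ennreal q \<partial>measure_pmf hard_problem)"
    unfolding mean_calls_def by (rule nn_integral_mono_AE)
  thus ?thesis by simp
qed

lemma exists_hard_problem:
  assumes "mean_mistakes conv xs hard_problem R L \<ge> \<beta>"
  shows "\<exists>p\<in>problems conv (set xs). expected_mistakes conv xs R L p \<ge> \<beta>"
proof (rule ccontr)
  assume "\<not> ?thesis"
  hence "expected_mistakes conv xs R L (problem_of w) < \<beta>" for w
    using problem_of_in_problems[of w] by (auto simp: not_le)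
  hence "(\<Sum>w\<in>Pow (coins J 0). expected_mistakes conv xs R L (problem_of w))
      < (\<Sum>w\<in>Pow (coins J 0). \<beta>)"
    by (intro sum_strict_mono) auto
  hence "mean_mistakes conv xs hard_problem R L < \<beta>"
    by (simp add: mean_mistakes_def expectation_hard_problem card_Pow field_simps)
  thus False using assms by simp
qed

end

end

theorem theorem3p2:
  fixes T :: nat and conv :: "'a convention" and I :: "'a set"
  assumes "T \<ge> 1" and "finite I" and "card I = T" and "sentinel_fresh conv I"
  shows "\<exists>(xs :: 'a list) (D :: ('a rel \<times> 'a) pmf).
    distinct xs \<and> set xs = I \<and>
    finite (set_pmf D) \<and> set_pmf D \<subseteq> problems conv I \<and>
    (\<forall>R L. randomized_learner conv xs R L \<longrightarrow>
       mean_mistakes conv xs D R L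
         \<ge> ((real T + 1 - eps conv) * pow128_neg (mean_calls conv xs D R L) - 1) / 2 \<and>
       (\<forall>q::real. q \<ge> 0 \<longrightarrow>
          mean_calls conv xs D R L \<le> ennreal q \<or>
          (AE p in measure_pmf D. AE \<omega> in R. real (oracle_calls conv xs (L \<omega>) p) \<le> q) \<longrightarrow>
          mean_mistakes conv xs D R L
            \<ge> max 0 (((real T + 1 - eps conv) * 128 powr (- q) - 1) / 2)) \<and>
       (\<forall>q::real. q \<ge> 0 \<longrightarrow>
          (\<forall>p\<in>problems conv I. expected_calls conv xs R L p \<le> ennreal q) \<longrightarrow>
          (\<exists>p\<in>problems conv I. expected_mistakes conv xs R L p
            \<ge> max 0 (((real T + 1 - eps conv) * 128 powr (- q) - 1) / 2))))"
proof -
  \<comment> \<open>Any order of arrival will do, because \<open>latter\<close> is defined from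
    it.\<close>
  obtain xs where xs: "distinct xs" "set xs = I"
    using finite_distinct_list[OF assms(2)] by blast
  \<comment> \<open>Under convention N the first instance plays the part of the sentinel. Its label
    is always positive, so one random label is lost, which is the source of
    \<open>eps\<close>.\<close>
  define s where "s = (case conv of Conv_E s \<Rightarrow> s | Conv_N \<Rightarrow> hd xs)"
  have s: "insert s I = points conv I" "real (card (I - {s})) + 1 = real T + 1 - eps conv"
  proof -
    have "hd xs \<in> I" using assms(1,3) xs by (cases xs) auto
    thus "insert s I = points conv I" "real (card (I - {s})) + 1 = real T + 1 - eps conv"
      using assms by (cases conv; auto simp: s_def of_nat_diff)+
  qed
  obtain rk :: "'a \<Rightarrow> nat" where "inj_on rk (insert s (set xs))"
    using finite_imp_inj_to_nat_seg[of "insert s (set xs)"] by auto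
  with xs(1) interpret layered_orders s xs rk by unfold_locales
  have points: "points conv (set xs) = X" using s(1) xs(2) by (simp add: X_def)
  have adm: "admissible conv (set xs) (ord w)" for w
  proof -
    have "sentinel_least conv (set xs) (ord w)"
    proof (cases conv)
      case (Conv_E a)
      hence "a = s" by (simp add: s_def)
      thus ?thesis using s_least[of _ w] by (auto simp: Conv_E ord_def X_def)
    qed simp
    thus ?thesis by (simp add: admissible_def points linear_order_ord)
  qed
  have card: "real (card J) + 1 = real T + 1 - eps conv"
    using s(2) xs(2) by (simp add: J_def)
  have main: "set_pmf hard_problem \<subseteq> problems conv I" "finite (set_pmf hard_problem)"
    using adm target_in_X points xs(2)
    by (auto simp: set_hard_problem problem_of_def problems_def)
  have bounds: "mean_mistakes conv xs hard_problem R L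
         \<ge> ((real T + 1 - eps conv) * pow128_neg (mean_calls conv xs hard_problem R L) - 1) / 2 \<and>
       (\<forall>q::real. q \<ge> 0 \<longrightarrow>
          mean_calls conv xs hard_problem R L \<le> ennreal q \<or>
          (AE p in measure_pmf hard_problem. AE \<omega> in R. real (oracle_calls conv xs (L \<omega>) p) \<le> q) \<longrightarrow>
          mean_mistakes conv xs hard_problem R L
            \<ge> max 0 (((real T + 1 - eps conv) * 128 powr (- q) - 1) / 2)) \<and>
       (\<forall>q::real. q \<ge> 0 \<longrightarrow>
          (\<forall>p\<in>problems conv I. expected_calls conv xs R L p \<le> ennreal q) \<longrightarrow>
          (\<exists>p\<in>problems conv I. expected_mistakes conv xs R L p
            \<ge> max 0 (((real T + 1 - eps conv) * 128 powr (- q) - 1) / 2)))"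
    if learner: "randomized_learner conv xs R L" for R L
  proof (intro conjI allI impI)
    note ctx = points adm learner
    show "mean_mistakes conv xs hard_problem R L
         \<ge> ((real T + 1 - eps conv) * pow128_neg (mean_calls conv xs hard_problem R L) - 1) / 2"
      using mean_mistakes_ge[OF ctx] by (simp only: card)
    note bound = mean_mistakes_ge_of_calls_le[OF ctx, unfolded card]
    fix q :: real assume q: "q \<ge> 0"
    show "mean_mistakes conv xs hard_problem R L
            \<ge> max 0 (((real T + 1 - eps conv) * 128 powr (- q) - 1) / 2)"
      if "mean_calls conv xs hard_problem R L \<le> ennreal q \<or>
          (AE p in measure_pmf hard_problem. AE \<omega> in R. real (oracle_calls conv xs (L \<omega>) p) \<le> q)"
      using that bound[OF q] mean_calls_le_of_AE[OF ctx q] by blast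
    show "\<exists>p\<in>problems conv I. expected_mistakes conv xs R L p
            \<ge> max 0 (((real T + 1 - eps conv) * 128 powr (- q) - 1) / 2)"
      if calls: "\<forall>p\<in>problems conv I. expected_calls conv xs R L p \<le> ennreal q"
    proof -
      have "mean_calls conv xs hard_problem R L \<le> (\<integral>\<^sup>+p. ennreal q \<partial>measure_pmf hard_problem)"
        unfolding mean_calls_def
        by (intro nn_integral_mono_AE) (use calls main(1) in \<open>auto simp: AE_measure_pmf_iff\<close>)
      hence "mean_calls conv xs hard_problem R L \<le> ennreal q" by simp
      from exists_hard_problem[OF ctx bound[OF q this]] show ?thesis by (simp only: xs(2))
    qed
  qed
  show ?thesis
    by (rule exI[of _ xs], rule exI[of _ hard_problem], intro conjI xs main,
        rule allI, rule allI, rule impI, rule bounds)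
qed

end
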